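(* For every $a(0) \in \ell^2(\mathbb{N})$, there exists a unique solution $a(t) \in \ell^2(\mathbb{N})$, for every $t \in \mathbb{R}$, to the evolution system $$2 \frac{d a_n}{dt} = \sqrt{n(n+1)(n+2)}\, a_{n+1} - \sqrt{(n-1) n (n+1)}\, a_{n-1}, \quad n \in \mathbb{N},$$ satisfying $\| a(t) \|_{\ell^2} = \| a(0) \|_{\ell^2}$.
   Context: $\mathbb{N} = \{1,2,3,\dots\}$; for $n=1$ the coefficient of $a_0$ is zero. In the paper, the system is rewritten by the transformation $a_n = i^n f_n$ as $\frac{df}{dt} = \frac{i}{2} J f$ with the Jacobi operator $(J f)_n = \sqrt{n(n+1)(n+2)} f_{n+1} + \sqrt{(n-1) n (n+1)} f_{n-1}$, where $J$ is realized as the self-adjoint operator $\mathcal{J}$ in $\ell^2(\mathbb{N})$ with domain $\{ f \in \ell^2(\mathbb{N}) : Jf \in \ell^2(\mathbb{N}),\ \lim_{n\to\infty} \sqrt{n(n+1)(n+2)}(v_n f_{n+1} - v_{n+1} f_n) = 0\}$; here $v$ is the solution of $Jv=0$ with $v_1=1$. Solutions are understood in the sense of the solution operator $e^{\frac{i}{2}\mathcal{J}t}$. *)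

theory Defs
  imports "HOL-Analysis.Analysis"
begin

text \<open>
  The index set is $\{1,2,3,\dots\}$. A sequence is a function on \<^typ>\<open>nat\<close> whose entry at the
  dummy index 0 is pinned to 0, so that equality of functions is equality of sequences.
\<close>

definition ell2 :: "(nat \<Rightarrow> complex) set" where
  "ell2 = {f. f 0 = 0 \<and> summable (\<lambda>n. (cmod (f n))\<^sup>2)}"

definition ell2_norm :: "(nat \<Rightarrow> complex) \<Rightarrow> real" where
  "ell2_norm f = sqrt (\<Sum>n. (cmod (f n))\<^sup>2)"

text \<open>
  Off-diagonal entries $\sqrt{n(n+1)(n+2)}$. The entry in front of the term with index $n-1$ is
  the weight at $n-1$; it vanishes for $n=1$.
\<close>

definition weight :: "nat \<Rightarrow> real" where
  "weight n = sqrt (real n * (real n + 1) * (real n + 2))"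

definition jacobi :: "(nat \<Rightarrow> complex) \<Rightarrow> nat \<Rightarrow> complex" where
  "jacobi f n = of_real (weight n) * f (n + 1) + of_real (weight (n - 1)) * f (n - 1)"

definition is_null_solution :: "(nat \<Rightarrow> complex) \<Rightarrow> bool" where
  "is_null_solution v \<longleftrightarrow> v 0 = 0 \<and> v 1 = 1 \<and> (\<forall>n\<ge>1. jacobi v n = 0)"

lemma ex1_null_solution: "\<exists>!v. is_null_solution v"
proof -
  have w: "weight (Suc n) \<noteq> 0" for n
    by (simp add: weight_def add_nonneg_eq_0_iff)
  define p where "p = rec_nat (0::complex, 1::complex)
    (\<lambda>n q. (snd q, - (of_real (weight n) / of_real (weight (Suc n))) * fst q))"
  have p: "p 0 = (0, 1)"
    "p (Suc n) = (snd (p n), - (of_real (weight n) / of_real (weight (Suc n))) * fst (p n))" for n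
    by (simp_all add: p_def)
  have "is_null_solution (\<lambda>n. fst (p n))"
    unfolding is_null_solution_def
  proof (intro conjI allI impI)
    fix n :: nat
    assume "1 \<le> n"
    then obtain m where "n = Suc m"
      by (cases n) auto
    then show "jacobi (\<lambda>n. fst (p n)) n = 0"
      using w[of m] by (simp add: jacobi_def p)
  qed (simp_all add: p)
  moreover have "u = v" if u: "is_null_solution u" and v: "is_null_solution v" for u v
  proof -
    have "u n = v n \<and> u (Suc n) = v (Suc n)" for n
    proof (induction n)
      case 0
      then show ?case
        using u v by (simp add: is_null_solution_def)
    next
      case (Suc n)
      have "jacobi u (Suc n) = 0" "jacobi v (Suc n) = 0"
        using u v by (simp_all add: is_null_solution_def)
      then have "of_real (weight (Suc n)) * u (Suc (Suc n))
          = of_real (weight (Suc n)) * v (Suc (Suc n))"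
        using Suc by (simp add: jacobi_def add_eq_0_iff2)
      then show ?case
        using Suc w[of n] by simp
    qed
    then show ?thesis
      by auto
  qed
  ultimately show ?thesis
    by blast
qed

definition null_solution :: "nat \<Rightarrow> complex" where
  "null_solution = (THE v. is_null_solution v)"

text \<open>
  The symmetric operator given by \<^const>\<open>jacobi\<close> on finitely supported sequences is not essentially
  self-adjoint (limit circle case at infinity). The vanishing Wronskian with
  \<^const>\<open>null_solution\<close> selects the self-adjoint realization.
\<close>

definition jacobi_domain :: "(nat \<Rightarrow> complex) set" where
  "jacobi_domain = {f \<in> ell2. jacobi f \<in> ell2 \<and>
     (\<lambda>n. of_real (weight n) * (null_solution n * f (n + 1) - null_solution (n + 1) * f n))
       \<longlonglongrightarrow> 0}"

text \<open>
  Strongly continuous one-parameter groups of bounded operators on \<^const>\<open>ell2\<close>. Only the values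
  on \<^const>\<open>ell2\<close> matter, and unitarity is not assumed.
\<close>

definition C0_group :: "(real \<Rightarrow> (nat \<Rightarrow> complex) \<Rightarrow> nat \<Rightarrow> complex) \<Rightarrow> bool" where
  "C0_group U \<longleftrightarrow>
     (\<forall>t. \<forall>f\<in>ell2. U t f \<in> ell2) \<and>
     (\<forall>t c d. \<forall>f\<in>ell2. \<forall>g\<in>ell2.
        U t (\<lambda>n. c * f n + d * g n) = (\<lambda>n. c * U t f n + d * U t g n)) \<and>
     (\<forall>t. \<exists>C. \<forall>f\<in>ell2. ell2_norm (U t f) \<le> C * ell2_norm f) \<and>
     (\<forall>f\<in>ell2. U 0 f = f) \<and>
     (\<forall>s t. \<forall>f\<in>ell2. U (s + t) f = U s (U t f)) \<and>
     (\<forall>f\<in>ell2. ((\<lambda>t. ell2_norm (\<lambda>n. U t f n - f n)) \<longlongrightarrow> 0) (at 0))"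

text \<open>
  The infinitesimal generator of \<open>U\<close> is the operator \<open>B\<close> with domain \<open>D\<close>: the difference quotient
  of \<open>U\<close> at \<open>f\<close> converges in norm exactly for the elements \<open>f\<close> of \<open>D\<close>, with limit \<open>B f\<close>.
  Then $U(t) = e^{tB}$.
\<close>

definition generates ::
  "(nat \<Rightarrow> complex) set \<Rightarrow> ((nat \<Rightarrow> complex) \<Rightarrow> nat \<Rightarrow> complex) \<Rightarrow>
    (real \<Rightarrow> (nat \<Rightarrow> complex) \<Rightarrow> nat \<Rightarrow> complex) \<Rightarrow> bool" where
  "generates D B U \<longleftrightarrow> C0_group U \<and>
     (\<forall>f\<in>ell2. \<forall>g\<in>ell2.
        ((\<lambda>h. ell2_norm (\<lambda>n. (U h f n - f n) / of_real h - g n)) \<longlongrightarrow> 0) (at 0)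
          \<longleftrightarrow> f \<in> D \<and> g = B f)"

definition is_solution_operator :: "(real \<Rightarrow> (nat \<Rightarrow> complex) \<Rightarrow> nat \<Rightarrow> complex) \<Rightarrow> bool" where
  "is_solution_operator U \<longleftrightarrow> generates jacobi_domain (\<lambda>f n. \<i> / 2 * jacobi f n) U"

definition satisfies_system :: "(real \<Rightarrow> nat \<Rightarrow> complex) \<Rightarrow> bool" where
  "satisfies_system a \<longleftrightarrow>
     (\<forall>t. \<forall>n\<ge>1. ((\<lambda>s. 2 * a s n) has_vector_derivative
        of_real (sqrt (real n * (real n + 1) * (real n + 2))) * a t (n + 1)
        - of_real (sqrt ((real n - 1) * real n * (real n + 1))) * a t (n - 1)) (at t))"

text \<open>
  Solutions satisfy the system entrywise and are given by the solution operator after the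
  substitution $a_n = i^n f_n$. The entrywise equations alone do not determine the solution: each
  self-adjoint extension of the minimal operator yields norm-preserving solutions of them.
\<close>

definition is_solution :: "(real \<Rightarrow> nat \<Rightarrow> complex) \<Rightarrow> bool" where
  "is_solution a \<longleftrightarrow>
     (\<forall>t. a t \<in> ell2) \<and> satisfies_system a \<and>
     (\<exists>U f. is_solution_operator U \<and> (\<forall>t n. a t n = \<i> ^ n * f t n) \<and> (\<forall>t. f t = U t (f 0)))"

end

theory Submission
  imports Defs
begin

text \<open>
  After $a_n = i^n f_n$ the claim is Stone's theorem for $B = \frac{i}{2}\mathcal{J}$.

  Write $W$ for the Wronskian, $v$ for the null solution and $u$ for a second solution of $Ju = 0$
  away from the boundary. By Green's identity $W_n(v,f)$ is the partial sum of
  $\langle v, Jf\rangle$, so the boundary condition says $Jf \perp v$ and the graph of $B$ is closed.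
  Both $u$ and $v$ are square summable; hence $W(f,u)$ is bounded when $f, Jf \in \ell^2$, and
  $W(f,g)W(u,v) = W(f,u)W(g,v) - W(f,v)W(g,u)$ makes $W(f,g)$ vanish at infinity on the domain, so $B$
  is skew. A vector orthogonal to the range of $1 - hB$ solves $Bz = -z/h$ entrywise and, being
  orthogonal to $v$, satisfies the boundary condition, so it is zero by skewness; the range of
  $1 - hB$ is therefore everything. The exponentials of the symmetric Yosida approximations of $B$
  converge to a group of isometries with generator exactly $B$.

  Uniqueness holds because $y' = By$ with values in the domain keeps $\|y\|$ constant. Components of a
  solution with arbitrary initial value are differentiated by pairing with unit vectors, which lie in
  the domain.
\<close>

section \<open>The exponential of a bounded operator\<close>

text \<open>The deficiency argument closes because \<open>null_solution\<close> itself satisfies the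
  boundary condition and lies in the kernel of B: a vector orthogonal to the range of 1 - hB is
  therefore orthogonal to v. Both solutions of Js = 0 are square summable because the recursion
  forces |s_n|^2 to decay like n^(-3/2). The abstract part works over the real inner product Re <x,
  y>, where skewness is just inner (B x) x = 0; complex linearity of the group is recovered at the
  end, since the group commutes with multiplication by a complex scalar. The usual Yosida
  approximation B(1 - hB)^(-1) is not skew: its quadratic form at x is -h |Bg|^2 with g = (1 -
  hB)^(-1) x. Averaging it over h and -h restores skewness, and with it isometric exponentials for
  both signs of time. A solution may come from any solution operator, so its uniqueness rests on
  uniqueness of the group with a given generator.\<close>

text \<open>
  A copy of the space of bounded endomorphisms whose multiplication is composition, so that
  \<^const>\<open>exp\<close> is available for operators.
\<close>

typedef (overloaded) 'a operator =
  "UNIV :: ('a::{banach, perfect_space} \<Rightarrow>\<^sub>L 'a) set"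
  morphisms blin Operator ..

setup_lifting type_definition_operator

instantiation operator :: ("{banach, perfect_space}") real_normed_algebra_1
begin

lift_definition norm_operator :: "'a operator \<Rightarrow> real" is norm .

lift_definition minus_operator :: "'a operator \<Rightarrow> 'a operator \<Rightarrow> 'a operator" is "(-)" .

lift_definition uminus_operator :: "'a operator \<Rightarrow> 'a operator" is uminus .

lift_definition zero_operator :: "'a operator" is 0 .

lift_definition one_operator :: "'a operator" is id_blinfun .

lift_definition plus_operator :: "'a operator \<Rightarrow> 'a operator \<Rightarrow> 'a operator" is "(+)" .

lift_definition times_operator :: "'a operator \<Rightarrow> 'a operator \<Rightarrow> 'a operator" is "(o\<^sub>L)" .

lift_definition scaleR_operator :: "real \<Rightarrow> 'a operator \<Rightarrow> 'a operator" is "(*\<^sub>R)" .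

definition dist_operator :: "'a operator \<Rightarrow> 'a operator \<Rightarrow> real"
  where "dist_operator a b = norm (a - b)"

definition [code del]:
  "(uniformity :: ('a operator \<times> 'a operator) filter) =
    (INF e\<in>{0<..}. principal {(x, y). dist x y < e})"

definition open_operator :: "'a operator set \<Rightarrow> bool"
  where [code del]:
    "open_operator S = (\<forall>x\<in>S. \<forall>\<^sub>F (x', y) in uniformity. x' = x \<longrightarrow> y \<in> S)"

definition sgn_operator :: "'a operator \<Rightarrow> 'a operator"
  where "sgn_operator x = inverse (norm x) *\<^sub>R x"

instance
proof
  fix a b c :: "'a operator" and r s :: real
  show "dist a b = norm (a - b)"
    by (simp add: dist_operator_def)
  show "sgn a = inverse (norm a) *\<^sub>R a"
    by (simp add: sgn_operator_def)
  show "(uniformity :: ('a operator \<times> 'a operator) filter) =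
      (INF e\<in>{0<..}. principal {(x, y). dist x y < e})"
    by (simp add: uniformity_operator_def)
  show "open S = (\<forall>x\<in>S. \<forall>\<^sub>F (x', y) in uniformity. x' = x \<longrightarrow> y \<in> S)" for S :: "'a operator set"
    by (simp add: open_operator_def)
  show "a * b * c = a * (b * c)"
    by transfer (rule blinfun_eqI, simp)
  show "(a + b) * c = a * c + b * c" "a * (b + c) = a * b + a * c"
    "r *\<^sub>R a * b = r *\<^sub>R (a * b)" "a * r *\<^sub>R b = r *\<^sub>R (a * b)"
    by (transfer, rule blinfun_eqI, simp add: blinfun.bilinear_simps)+
  show "1 * a = a" "a * 1 = a"
    by (transfer, rule blinfun_eqI, simp)+
  show "norm (a * b) \<le> norm a * norm b"
    by transfer (rule norm_blinfun_compose)
  \<comment> \<open>This and the next goal exclude the trivial space; \<open>perfect_space\<close>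
    is assumed for their sake.\<close>
  show "norm (1 :: 'a operator) = 1"
    by transfer (rule norm_blinfun_id)
  show "(0 :: 'a operator) \<noteq> 1"
    by transfer (metis norm_blinfun_id norm_zero zero_neq_one)
  show "norm (a + b) \<le> norm a + norm b"
    by transfer (rule norm_triangle_ineq)
qed (transfer; simp add: algebra_simps)+

end

instance operator :: ("{banach, perfect_space}") banach
proof
  fix X :: "nat \<Rightarrow> 'a operator"
  assume X: "Cauchy X"
  have n: "norm (blin a - blin b) = norm (a - b)" for a b :: "'a operator"
    by transfer simp
  have "Cauchy (\<lambda>n. blin (X n))"
    using X by (simp add: Cauchy_def dist_norm n)
  then obtain L where "(\<lambda>n. blin (X n)) \<longlonglongrightarrow> L"
    using Cauchy_convergent convergent_def by blast
  then have "(\<lambda>n. norm (blin (X n) - blin (Operator L))) \<longlonglongrightarrow> 0"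
    by (simp add: Operator_inverse LIM_zero_iff tendsto_norm_zero_iff)
  then have "(\<lambda>n. norm (X n - Operator L)) \<longlonglongrightarrow> 0"
    by (simp add: n)
  then show "convergent X"
    using LIM_zero_cancel convergent_def tendsto_norm_zero_iff by blast
qed

definition expo :: "('a::{banach, perfect_space} \<Rightarrow>\<^sub>L 'a) \<Rightarrow> real \<Rightarrow> 'a \<Rightarrow>\<^sub>L 'a" where
  "expo A t = blin (exp (t *\<^sub>R Operator A))"

lemma bounded_linear_blin_apply: "bounded_linear (\<lambda>X. blinfun_apply (blin X) x)"
proof (rule bounded_linear_intro)
  show "blinfun_apply (blin (X + Y)) x = blin X x + blin Y x" for X Y :: "'a operator"
    by transfer (simp add: blinfun.bilinear_simps)
  show "blinfun_apply (blin (r *\<^sub>R X)) x = r *\<^sub>R blin X x" for r and X :: "'a operator"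
    by transfer (simp add: blinfun.bilinear_simps)
  show "norm (blinfun_apply (blin X) x) \<le> norm X * norm x" for X :: "'a operator"
    by transfer (rule norm_blinfun)
qed

lemma blin_Operator [simp]: "blin (Operator A) = A"
  by (simp add: Operator_inverse)

lemma blin_times [simp]: "blin (X * Y) = blin X o\<^sub>L blin Y"
  by transfer simp

lemma blin_one [simp]: "blin 1 = id_blinfun"
  by transfer simp

lemma Operator_blin [simp]: "Operator (blin X) = X"
  by (simp add: blin_inverse)

lemma expo_0 [simp]: "expo A 0 x = x"
  by (simp add: expo_def)

lemma expo_has_vector_derivative:
  "((\<lambda>t. expo A t x) has_vector_derivative A (expo A t x)) (at t within T)"
proof -
  have "((\<lambda>t. exp (t *\<^sub>R Operator A)) has_vector_derivative
      Operator A * exp (t *\<^sub>R Operator A)) (at t within T)"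
    using exp_scaleR_has_vector_derivative_left has_vector_derivative_at_within by blast
  from bounded_linear.has_vector_derivative[OF bounded_linear_blin_apply this, of x]
  show ?thesis
    by (simp add: expo_def)
qed

lemma expo_add:
  assumes "A o\<^sub>L C = C o\<^sub>L A"
  shows "expo (A + C) t x = expo A t (expo C t x)"
proof -
  have c: "Operator A * Operator C = Operator C * Operator A"
    using assms by (metis Operator_blin blin_Operator blin_times)
  have "Operator (A + C) = Operator A + Operator C"
    by (simp add: plus_operator.abs_eq)
  then show ?thesis
    using c by (simp add: expo_def scaleR_add_right exp_add_commuting)
qed

lemma expo_plus: "expo A (s + t) x = expo A s (expo A t x)"
  by (simp add: expo_def scaleR_add_left exp_add_commuting)

lemma expo_commute: "A (expo A t x) = expo A t (A x)"
proof -
  have "exp (t *\<^sub>R Operator A) * Operator A = Operator A * exp (t *\<^sub>R Operator A)"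
    by (rule exp_times_scaleR_commute)
  then show ?thesis
    by (metis blin_Operator blin_times blinfun_apply_blinfun_compose expo_def)
qed

lemma norm_expo:
  fixes A :: "'a::{real_inner, banach, perfect_space} \<Rightarrow>\<^sub>L 'a"
  assumes "\<And>x. inner (A x) x = 0"
  shows "norm (expo A t x) = norm x"
proof -
  have "((\<lambda>t. inner (expo A t x) (expo A t x)) has_vector_derivative
      inner (expo A t x) (A (expo A t x)) + inner (A (expo A t x)) (expo A t x)) (at t)" for t
    by (rule bounded_bilinear.has_vector_derivative[OF bounded_bilinear_inner])
      (rule expo_has_vector_derivative)+
  then have "\<forall>t. DERIV (\<lambda>t. inner (expo A t x) (expo A t x)) t :> 0"
    by (simp add: has_real_derivative_iff_has_vector_derivative assms inner_commute[of "expo A t x" "A _" for t])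
  from DERIV_isconst_all[OF this, of t 0] show ?thesis
    by (simp add: norm_eq_sqrt_inner)
qed

text \<open>Mean value inequality along the orbit. The free vector \<open>y\<close> serves two ends:
  \<open>y\<close> = 0 gives a Lipschitz bound in time, and the value of the limiting generator at
  \<open>x\<close> gives control of the difference quotient.\<close>

lemma norm_expo_diff_le:
  assumes "\<And>s. \<bar>s\<bar> \<le> \<bar>t\<bar> \<Longrightarrow> norm (expo A s (A x) - y) \<le> c"
  shows "norm (expo A t x - x - t *\<^sub>R y) \<le> \<bar>t\<bar> * c"
proof -
  let ?g = "\<lambda>s. expo A s x - s *\<^sub>R y"
  have "norm (?g t - ?g 0) \<le> c * norm (t - 0)"
  proof (rule differentiable_bound)
    show "convex (cball (0::real) \<bar>t\<bar>)"
      by simp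
    fix s
    assume s: "s \<in> cball (0::real) \<bar>t\<bar>"
    show "(?g has_derivative (\<lambda>h. h *\<^sub>R (expo A s (A x) - y))) (at s within cball 0 \<bar>t\<bar>)"
      unfolding has_vector_derivative_def[symmetric]
      by (rule derivative_eq_intros expo_has_vector_derivative refl)+
        (simp add: expo_commute)
    have "norm (expo A s (A x) - y) \<le> c"
      using assms s by simp
    then show "onorm (\<lambda>h. h *\<^sub>R (expo A s (A x) - y)) \<le> c"
      by (intro onorm_le) (auto simp: mult.commute[of c] intro: mult_left_mono)
  qed auto
  then show ?thesis
    by (simp add: algebra_simps)
qed

section \<open>Skew-symmetric operators and the groups they generate\<close>

lemma contraction_tendsto_dense:
  fixes T :: "'i \<Rightarrow> 'a::real_normed_vector \<Rightarrow> 'a"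
  assumes lin: "\<And>n. linear (T n)" and le: "\<And>n x. norm (T n x) \<le> norm x"
    and D: "closure D = UNIV" "\<And>x. x \<in> D \<Longrightarrow> ((\<lambda>n. T n x) \<longlongrightarrow> x) F"
  shows "((\<lambda>n. T n x) \<longlongrightarrow> x) F"
proof (rule tendstoI)
  fix e :: real
  assume e: "0 < e"
  obtain y where y: "y \<in> D" "dist y x < e / 3"
    using D(1) e by (metis UNIV_I closure_approachable divide_pos_pos zero_less_numeral)
  have "\<forall>\<^sub>F n in F. dist (T n y) y < e / 3"
    using D(2)[OF y(1)] e by (intro tendstoD) auto
  then show "\<forall>\<^sub>F n in F. dist (T n x) x < e"
  proof eventually_elim
    case (elim n)
    have "norm (T n x - T n y) \<le> norm (x - y)"
      using le[of n "x - y"] lin[of n] by (simp add: linear_diff)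
    then show ?case
      using elim y(2) dist_triangle[of "T n x" x "T n y"] dist_triangle[of "T n y" x y]
      by (simp add: dist_norm norm_minus_commute)
  qed
qed

lemma isometry_Cauchy_dense:
  fixes T :: "nat \<Rightarrow> 'a::real_normed_vector \<Rightarrow> 'a"
  assumes lin: "\<And>n. linear (T n)" and le: "\<And>n x. norm (T n x) \<le> norm x"
    and D: "closure D = UNIV" "\<And>x. x \<in> D \<Longrightarrow> Cauchy (\<lambda>n. T n x)"
  shows "Cauchy (\<lambda>n. T n x)"
proof (rule metric_CauchyI)
  fix e :: real
  assume e: "0 < e"
  obtain y where y: "y \<in> D" "dist y x < e / 3"
    using D(1) e by (metis UNIV_I closure_approachable divide_pos_pos zero_less_numeral)
  obtain M where M: "\<And>m n. m \<ge> M \<Longrightarrow> n \<ge> M \<Longrightarrow> dist (T m y) (T n y) < e / 3"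
    using metric_CauchyD[OF D(2)[OF y(1)], of "e / 3"] e by auto
  have near: "dist (T n x) (T n y) < e / 3" for n
    using le[of n "x - y"] lin[of n] y(2) by (simp add: linear_diff dist_norm norm_minus_commute)
  have "dist (T m x) (T n x) < e" if "m \<ge> M" "n \<ge> M" for m n
    using M[OF that] near[of m] near[of n] dist_triangle[of "T m x" "T n x" "T m y"]
      dist_triangle[of "T m y" "T n x" "T n y"]
    by (simp add: dist_commute)
  then show "\<exists>M. \<forall>m\<ge>M. \<forall>n\<ge>M. dist (T m x) (T n x) < e"
    by blast
qed

text \<open>Only real scalars occur. For a complex Hilbert space the inner product is the real part
  of the complex one, and \<open>B_skew\<close> then says that the complex form <Bx, x> is purely
  imaginary.\<close>

locale skew_operator =
  fixes D :: "'a::{real_inner, banach, perfect_space} set" and B :: "'a \<Rightarrow> 'a"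
  assumes subspace_D: "subspace D"
    and B_add: "x \<in> D \<Longrightarrow> y \<in> D \<Longrightarrow> B (x + y) = B x + B y"
    and B_scaleR: "x \<in> D \<Longrightarrow> B (c *\<^sub>R x) = c *\<^sub>R B x"
    and B_skew: "x \<in> D \<Longrightarrow> inner (B x) x = 0"
    and dense_D: "closure D = UNIV"
begin

lemma D_closed [simp]:
  "0 \<in> D" "x \<in> D \<Longrightarrow> y \<in> D \<Longrightarrow> x + y \<in> D" "x \<in> D \<Longrightarrow> y \<in> D \<Longrightarrow> x - y \<in> D"
  "x \<in> D \<Longrightarrow> c *\<^sub>R x \<in> D"
  using subspace_D by (auto simp: subspace_0 subspace_add subspace_diff subspace_scale)

lemma B_diff: "x \<in> D \<Longrightarrow> y \<in> D \<Longrightarrow> B (x - y) = B x - B y"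
  using B_add[of x "-1 *\<^sub>R y"] B_scaleR[of y "-1"] D_closed(4)[of y "-1"] by simp

lemma B_skew2:
  assumes "x \<in> D" "y \<in> D"
  shows "inner (B x) y = - inner x (B y)"
proof -
  have "inner (B (x + y)) (x + y) = 0"
    using assms by (intro B_skew) simp
  then show ?thesis
    using assms B_skew[OF assms(1)] B_skew[OF assms(2)]
    by (simp add: B_add inner_add_left inner_add_right inner_commute)
qed

text \<open>Pythagoras, since \<open>x\<close> and \<open>B x\<close> are orthogonal. This gives
  injectivity of 1 - hB, contractive inverses and, later, closed range, for either sign of
  \<open>h\<close>.\<close>

lemma norm_le_resolvent:
  assumes "x \<in> D"
  shows "norm x \<le> norm (x - h *\<^sub>R B x)"
proof -
  have "(norm (x - h *\<^sub>R B x))\<^sup>2 = (norm x)\<^sup>2 + h\<^sup>2 * inner (B x) (B x)"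
    using B_skew[OF assms] unfolding power2_norm_eq_inner
    by (simp add: inner_diff_left inner_diff_right inner_commute power2_eq_square)
  then have "(norm x)\<^sup>2 \<le> (norm (x - h *\<^sub>R B x))\<^sup>2"
    by simp
  then show ?thesis
    by (rule power2_le_imp_le) simp
qed

text \<open>The derivative of the squared norm is twice inner (B y) y. Applied to an orbit this is
  conservation of the norm, applied to a difference of two orbits it is uniqueness.\<close>

lemma norm_flow_const:
  assumes "\<And>t. (y has_vector_derivative B (y t)) (at t)" "\<And>t. y t \<in> D"
  shows "norm (y t) = norm (y 0)"
proof -
  have "((\<lambda>t. inner (y t) (y t)) has_vector_derivative
      inner (y t) (B (y t)) + inner (B (y t)) (y t)) (at t)" for t
    by (rule bounded_bilinear.has_vector_derivative[OF bounded_bilinear_inner]) (rule assms)+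
  then have "\<forall>t. DERIV (\<lambda>t. inner (y t) (y t)) t :> 0"
    by (simp add: has_real_derivative_iff_has_vector_derivative B_skew[OF assms(2)]
        inner_commute[of "y _" "B _"])
  from DERIV_isconst_all[OF this, of t 0] show ?thesis
    by (simp add: norm_eq_sqrt_inner)
qed

end

locale generated_group = skew_operator D B
  for D :: "'a::{real_inner, banach, perfect_space} set" and B :: "'a \<Rightarrow> 'a" +
  fixes U :: "real \<Rightarrow> 'a \<Rightarrow> 'a"
  assumes bounded_linear_U: "bounded_linear (U t)"
    and U_0: "U 0 x = x"
    and U_plus: "U (s + t) x = U s (U t x)"
    and U_continuous: "((\<lambda>t. U t x) \<longlongrightarrow> x) (at 0)"
    and U_generator:
      "((\<lambda>h. (U h x - x) /\<^sub>R h) \<longlongrightarrow> y) (at 0) \<longleftrightarrow> x \<in> D \<and> y = B x"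
begin

text \<open>The bounded operator \<open>U t\<close> commutes with the difference quotients of the
  group, so it carries a convergent quotient to a convergent one; the equivalence
  \<open>U_generator\<close> then puts \<open>U t x\<close> into the domain.\<close>

lemma U_domain:
  assumes "x \<in> D"
  shows "U t x \<in> D" "B (U t x) = U t (B x)"
proof -
  interpret bounded_linear "U t"
    by (rule bounded_linear_U)
  have "((\<lambda>h. U t ((U h x - x) /\<^sub>R h)) \<longlongrightarrow> U t (B x)) (at 0)"
    using assms U_generator by (intro tendsto) blast
  moreover have "U t ((U h x - x) /\<^sub>R h) = (U h (U t x) - U t x) /\<^sub>R h" for h
    by (simp add: scaleR diff U_plus[symmetric] add.commute)
  ultimately have "((\<lambda>h. (U h (U t x) - U t x) /\<^sub>R h) \<longlongrightarrow> U t (B x)) (at 0)"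
    by simp
  then show "U t x \<in> D" "B (U t x) = U t (B x)"
    using U_generator by auto
qed

lemma U_has_vector_derivative:
  assumes "x \<in> D"
  shows "((\<lambda>s. U s x) has_vector_derivative B (U t x)) (at t)"
proof -
  have "((\<lambda>h. (U h (U t x) - U t x) /\<^sub>R h) \<longlongrightarrow> B (U t x)) (at 0)"
    using U_generator U_domain[OF assms] by blast
  then have "((\<lambda>h. norm ((U h (U t x) - U t x) /\<^sub>R h - B (U t x))) \<longlongrightarrow> 0) (at 0)"
    by (intro tendsto_norm_zero) (simp add: LIM_zero_iff)
  moreover have "\<forall>\<^sub>F h in at 0. norm ((U h (U t x) - U t x) /\<^sub>R h - B (U t x)) =
      norm (U (t + h) x - U t x - h *\<^sub>R B (U t x)) / norm h"
  proof (rule eventually_at_filter[THEN iffD2], rule always_eventually, intro allI impI)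
    fix h :: real
    assume h: "h \<noteq> 0"
    have "(U h (U t x) - U t x) /\<^sub>R h - B (U t x) =
        (U (t + h) x - U t x - h *\<^sub>R B (U t x)) /\<^sub>R h"
      using h by (simp add: U_plus[symmetric] add.commute scaleR_diff_right)
    then show "norm ((U h (U t x) - U t x) /\<^sub>R h - B (U t x)) =
      norm (U (t + h) x - U t x - h *\<^sub>R B (U t x)) / norm h"
      by (simp add: divide_inverse mult.commute)
  qed
  ultimately show ?thesis
    unfolding has_vector_derivative_def has_derivative_at
    by (auto simp: bounded_linear_scaleR_left elim: Lim_transform_eventually)
qed

lemma norm_U: "norm (U t x) = norm x"
proof -
  interpret bounded_linear "U t"
    by (rule bounded_linear_U)
  have "norm (U t y) = norm y" if "y \<in> D" for y
    using norm_flow_const[OF U_has_vector_derivative[OF that] U_domain(1)[OF that], of t]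
    by (simp add: U_0)
  moreover have "closed {y. norm (U t y) = norm y}"
    by (intro closed_Collect_eq continuous_intros) (auto intro!: continuous_on continuous_intros)
  ultimately have "closure D \<subseteq> {y. norm (U t y) = norm y}"
    by (intro closure_minimal) auto
  then show ?thesis
    using dense_D by auto
qed

text \<open>An isometry preserves inner products by polarization, and \<open>U (- t)\<close> inverts
  \<open>U t\<close>.\<close>

lemma inner_U: "inner (U t x) y = inner x (U (- t) y)"
proof -
  interpret bounded_linear "U t"
    by (rule bounded_linear_U)
  have polar: "inner u v = ((norm (u + v))\<^sup>2 - (norm u)\<^sup>2 - (norm v)\<^sup>2) / 2" for u v :: 'a
    by (simp add: power2_norm_eq_inner inner_add_left inner_add_right inner_commute)
  have "y = U t (U (- t) y)"
    by (simp add: U_plus[symmetric] U_0)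
  then have "inner (U t x) y = inner (U t x) (U t (U (- t) y))"
    by simp
  also have "\<dots> = inner x (U (- t) y)"
    unfolding polar by (simp add: norm_U add[symmetric])
  finally show ?thesis .
qed

text \<open>The orbit of an arbitrary \<open>x\<close> may fail to be differentiable in norm. Moving
  \<open>U t\<close> to the other factor leaves the orbit of \<open>e\<close>, which is
  differentiable.\<close>

lemma U_weak_derivative:
  assumes "e \<in> D"
  shows "((\<lambda>t. inner (U t x) e) has_vector_derivative - inner (U t x) (B e)) (at t)"
proof -
  have "((\<lambda>t. U (- t) e) has_vector_derivative (-1) *\<^sub>R B (U (- t) e)) (at t)"
    using vector_diff_chain_at[of uminus "-1" t "\<lambda>s. U s e", OF _ U_has_vector_derivative[OF assms]]
      has_vector_derivative_minus[OF has_vector_derivative_id, of "at t"]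
    by (simp add: o_def)
  then have "((\<lambda>t. inner x (U (- t) e)) has_vector_derivative inner x ((-1) *\<^sub>R B (U (- t) e))) (at t)"
    by (rule bounded_linear.has_vector_derivative[OF bounded_linear_inner_right])
  then show ?thesis
    using U_domain[OF assms] by (simp add: inner_U)
qed

end

text \<open>The difference of the two sides solves y' = By inside the domain and starts at 0, so it
  vanishes; density removes the restriction to the domain. With \<open>K\<close> the identity this
  is uniqueness of the group, with \<open>K\<close> = \<open>cmul c\<close> and \<open>U\<close> =
  \<open>V\<close> it is complex linearity.\<close>

lemma generated_group_intertwine:
  assumes "generated_group D B U" "generated_group D B V" and K: "bounded_linear K"
    and KD: "\<And>x. x \<in> D \<Longrightarrow> K x \<in> D" and KB: "\<And>x. x \<in> D \<Longrightarrow> B (K x) = K (B x)"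
  shows "K (U t x) = V t (K x)"
proof -
  interpret U: generated_group D B U by fact
  interpret V: generated_group D B V by fact
  interpret K: bounded_linear K by fact
  have eq: "K (U t y) = V t (K y)" if y: "y \<in> D" for y
  proof -
    have "norm (K (U t y) - V t (K y)) = norm (K (U 0 y) - V 0 (K y))"
    proof (rule U.norm_flow_const)
      show "K (U t y) - V t (K y) \<in> D" for t
        using y by (simp add: KD U.U_domain V.U_domain)
      have "((\<lambda>t. K (U t y) - V t (K y)) has_vector_derivative
          K (B (U t y)) - B (V t (K y))) (at t)" for t
        using y by (intro has_vector_derivative_diff K.has_vector_derivative
            U.U_has_vector_derivative V.U_has_vector_derivative KD)
      then show "((\<lambda>t. K (U t y) - V t (K y)) has_vector_derivative
          B (K (U t y) - V t (K y))) (at t)" for t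
        using y by (simp add: U.B_diff KB KD U.U_domain(1) V.U_domain(1))
    qed
    then show ?thesis
      by (simp add: U.U_0 V.U_0)
  qed
  interpret u: bounded_linear "U t"
    by (rule U.bounded_linear_U)
  interpret v: bounded_linear "V t"
    by (rule V.bounded_linear_U)
  have "closed {y. K (U t y) = V t (K y)}"
    by (intro closed_Collect_eq) (auto intro!: K.continuous_on u.continuous_on v.continuous_on continuous_intros)
  then have "closure D \<subseteq> {y. K (U t y) = V t (K y)}"
    using eq by (intro closure_minimal) auto
  then show ?thesis
    using U.dense_D by auto
qed

text \<open>Full range for both signs of \<open>h\<close> is the counterpart of vanishing deficiency
  indices; a merely skew operator need not have it.\<close>

locale skew_adjoint_operator = skew_operator D B
  for D :: "'a::{real_inner, banach, perfect_space} set" and B :: "'a \<Rightarrow> 'a" +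
  assumes range: "h \<noteq> 0 \<Longrightarrow> \<exists>x\<in>D. x - h *\<^sub>R B x = y"
begin

section \<open>Resolvents and their algebra\<close>

lemma ex1_resolvent:
  assumes "h \<noteq> 0"
  shows "\<exists>!x. x \<in> D \<and> x - h *\<^sub>R B x = y"
proof -
  have "x = x'" if "x \<in> D" "x' \<in> D" "x - h *\<^sub>R B x = x' - h *\<^sub>R B x'" for x x'
  proof -
    have "(x - x') - h *\<^sub>R B (x - x') = 0"
      using that by (simp add: B_diff algebra_simps)
    then show ?thesis
      using norm_le_resolvent[of "x - x'" h] that by simp
  qed
  then show ?thesis
    using range[OF assms, of y] by blast
qed

text \<open>This is (1 - hB)^(-1), scaled so that it is a contraction and tends to the identity as
  \<open>h\<close> tends to 0.\<close>

definition resolvent :: "real \<Rightarrow> 'a \<Rightarrow> 'a" where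
  "resolvent h y = (THE x. x \<in> D \<and> x - h *\<^sub>R B x = y)"

lemma resolvent:
  assumes "h \<noteq> 0"
  shows "resolvent h y \<in> D" "resolvent h y - h *\<^sub>R B (resolvent h y) = y"
  using theI'[OF ex1_resolvent[OF assms, of y]] by (auto simp: resolvent_def)

lemma resolvent_eqI:
  assumes "h \<noteq> 0" "x \<in> D" "x - h *\<^sub>R B x = y"
  shows "resolvent h y = x"
  unfolding resolvent_def using assms by (intro the1_equality[OF ex1_resolvent]) auto

lemma norm_resolvent_le: "h \<noteq> 0 \<Longrightarrow> norm (resolvent h y) \<le> norm y"
  using norm_le_resolvent[OF resolvent(1), of h y h] by (simp add: resolvent(2))

lemma bounded_linear_resolvent:
  assumes "h \<noteq> 0"
  shows "bounded_linear (resolvent h)"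
proof (rule bounded_linear_intro)
  fix x y :: 'a and c :: real
  note r = resolvent[OF assms]
  have "resolvent h x + resolvent h y - h *\<^sub>R B (resolvent h x + resolvent h y) =
      (resolvent h x - h *\<^sub>R B (resolvent h x)) + (resolvent h y - h *\<^sub>R B (resolvent h y))"
    using r(1) by (simp add: B_add algebra_simps)
  then show "resolvent h (x + y) = resolvent h x + resolvent h y"
    unfolding r(2) using r(1) by (intro resolvent_eqI[OF assms]) auto
  have "c *\<^sub>R resolvent h x - h *\<^sub>R B (c *\<^sub>R resolvent h x) =
      c *\<^sub>R (resolvent h x - h *\<^sub>R B (resolvent h x))"
    using r(1) by (simp add: B_scaleR algebra_simps)
  then show "resolvent h (c *\<^sub>R x) = c *\<^sub>R resolvent h x"
    unfolding r(2) using r(1) by (intro resolvent_eqI[OF assms]) auto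
  show "norm (resolvent h x) \<le> norm x * 1"
    using norm_resolvent_le[OF assms] by simp
qed

text \<open>Both g = \<open>resolvent h x\<close> and x = g - h B g lie in the domain, hence so does
  B g; applying \<open>B\<close> to that equation shows that B g solves the equation defining
  \<open>resolvent h (B x)\<close>.\<close>

lemma B_resolvent:
  assumes h: "h \<noteq> 0" and x: "x \<in> D"
  shows "B (resolvent h x) \<in> D" "B (resolvent h x) = resolvent h (B x)"
proof -
  let ?g = "resolvent h x"
  have g: "?g \<in> D" "?g - h *\<^sub>R B ?g = x"
    using resolvent[OF h] by auto
  have "B ?g = (1 / h) *\<^sub>R (?g - (?g - h *\<^sub>R B ?g))"
    using h by simp
  then have "B ?g = (1 / h) *\<^sub>R (?g - x)"
    unfolding g(2) .
  then show BD: "B ?g \<in> D"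
    using g x by simp
  have "B ?g - h *\<^sub>R B (B ?g) = B (?g - h *\<^sub>R B ?g)"
    by (simp add: B_diff B_scaleR g(1) BD)
  then show "B ?g = resolvent h (B x)"
    unfolding g(2) by (rule resolvent_eqI[OF h BD, symmetric])
qed

text \<open>Apply \<open>resolvent h\<close> to x = f - k B f and move it past \<open>B\<close>:
  then \<open>resolvent h f\<close> solves the equation that defines
  \<open>resolvent k (resolvent h x)\<close>.\<close>

lemma resolvent_commute:
  assumes h: "h \<noteq> 0" and k: "k \<noteq> 0"
  shows "resolvent h (resolvent k x) = resolvent k (resolvent h x)"
proof -
  interpret R: bounded_linear "resolvent h"
    by (rule bounded_linear_resolvent[OF h])
  let ?f = "resolvent k x"
  have f: "?f \<in> D" "?f - k *\<^sub>R B ?f = x"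
    using resolvent[OF k] by auto
  have "resolvent h x = resolvent h ?f - k *\<^sub>R B (resolvent h ?f)"
    using R.diff[of ?f "k *\<^sub>R B ?f"] f B_resolvent[OF h f(1)] by (simp add: R.scaleR)
  then show ?thesis
    using resolvent_eqI[OF k resolvent(1)[OF h]] by metis
qed

text \<open>By skewness the adjoint of (1 - hB)^(-1) is (1 + hB)^(-1), and over the reals an
  operator and its adjoint have the same quadratic form. Hence the difference of the two resolvents
  is skew.\<close>

lemma resolvent_adjoint:
  assumes h: "h \<noteq> 0"
  shows "inner (resolvent h x) x = inner (resolvent (- h) x) x"
proof -
  let ?f = "resolvent h x" and ?g = "resolvent (- h) x"
  have f: "?f \<in> D" "?f - h *\<^sub>R B ?f = x" and g: "?g \<in> D" "?g + h *\<^sub>R B ?g = x"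
    using resolvent[of h x] resolvent[of "- h" x] h by auto
  have "inner ?f x = inner ?f ?g + h * inner ?f (B ?g)"
    using arg_cong[OF g(2), of "inner ?f"] by (simp add: inner_add_right)
  moreover have "inner ?g x = inner ?g ?f - h * inner ?g (B ?f)"
    using arg_cong[OF f(2), of "inner ?g"] by (simp add: inner_diff_right)
  ultimately show ?thesis
    using B_skew2[OF f(1) g(1)] by (simp add: inner_commute)
qed

lemma resolvent_tendsto:
  assumes h: "filterlim h (at 0) F"
  shows "((\<lambda>n. resolvent (h n) x) \<longlongrightarrow> x) F"
proof -
  \<comment> \<open>The identity fills in where \<open>h n\<close> = 0:
    \<open>contraction_tendsto_dense\<close> wants a linear contraction at every index, and
    \<open>resolvent\<close> is controlled only for nonzero steps.\<close>
  define T where "T n = (if h n = 0 then id else resolvent (h n))" for n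
  have ne: "\<forall>\<^sub>F n in F. h n \<noteq> 0"
    using h by (auto simp: filterlim_at)
  have "((\<lambda>n. T n x) \<longlongrightarrow> x) F"
  proof (rule contraction_tendsto_dense[OF _ _ dense_D])
    show "linear (T n)" for n
      using bounded_linear_resolvent[of "h n"]
      by (auto simp: T_def linear_id bounded_linear.linear)
    show "norm (T n y) \<le> norm y" for n y
      by (auto simp: T_def norm_resolvent_le)
    fix y
    assume y: "y \<in> D"
    have "norm (T n y - y) \<le> \<bar>h n\<bar> * norm (B y)" for n
    proof (cases "h n = 0")
      case False
      have "T n y - y = h n *\<^sub>R resolvent (h n) (B y)"
        using resolvent(2)[OF False, of y] B_resolvent(2)[OF False y] False
        by (simp add: T_def algebra_simps)
      then show ?thesis
        using norm_resolvent_le[OF False, of "B y"] by (simp add: mult_left_mono)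
    qed (simp add: T_def)
    moreover have "((\<lambda>n. \<bar>h n\<bar> * norm (B y)) \<longlongrightarrow> 0) F"
      using h by (intro tendsto_mult_left_zero tendsto_rabs_zero) (auto simp: filterlim_at)
    ultimately have "((\<lambda>n. T n y - y) \<longlongrightarrow> 0) F"
      by (metis (mono_tags, lifting) Lim_null_comparison always_eventually)
    then show "((\<lambda>n. T n y) \<longlongrightarrow> y) F"
      by (simp add: LIM_zero_iff)
  qed
  then show ?thesis
    by (rule Lim_transform_eventually) (use ne in eventually_elim, simp add: T_def)
qed

text \<open>
  The symmetric Yosida approximation $B(1-hB)^{-1}(1+hB)^{-1}$ is again skew, so it generates a
  group of isometries for both signs of time.
\<close>

definition yosida :: "real \<Rightarrow> 'a \<Rightarrow>\<^sub>L 'a" where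
  "yosida h = Blinfun (\<lambda>x. (1 / (2 * h)) *\<^sub>R (resolvent h x - resolvent (- h) x))"

lemma yosida_apply:
  assumes "h \<noteq> 0"
  shows "yosida h x = (1 / (2 * h)) *\<^sub>R (resolvent h x - resolvent (- h) x)"
proof -
  have "bounded_linear (\<lambda>x. (1 / (2 * h)) *\<^sub>R (resolvent h x - resolvent (- h) x))"
    using assms bounded_linear_sub[OF bounded_linear_resolvent[of h] bounded_linear_resolvent[of "- h"]]
    by (simp add: bounded_linear_const_scaleR)
  then show ?thesis
    by (simp add: yosida_def bounded_linear_Blinfun_apply)
qed

lemma inner_yosida: "h \<noteq> 0 \<Longrightarrow> inner (yosida h x) x = 0"
  using resolvent_adjoint[of h x] by (simp add: yosida_apply inner_diff_left)

lemma yosida_commute: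
  assumes h: "h \<noteq> 0" and k: "k \<noteq> 0"
  shows "yosida h o\<^sub>L yosida k = yosida k o\<^sub>L yosida h"
proof (rule blinfun_eqI)
  fix x
  have bl: "bounded_linear (resolvent h)" "bounded_linear (resolvent (- h))"
    "bounded_linear (resolvent k)" "bounded_linear (resolvent (- k))"
    using h k by (simp_all add: bounded_linear_resolvent)
  show "(yosida h o\<^sub>L yosida k) x = (yosida k o\<^sub>L yosida h) x"
    using h k resolvent_commute[of h k x] resolvent_commute[of h "- k" x]
      resolvent_commute[of "- h" k x] resolvent_commute[of "- h" "- k" x]
    by (simp add: yosida_apply bl[THEN bounded_linear.linear, THEN linear_diff]
        bl[THEN bounded_linear.linear, THEN linear_cmul] algebra_simps)
qed

text \<open>Partial fractions: 1/(1 - hb) - 1/(1 + hb) = 2hb/((1 - hb)(1 + hb)). On the domain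
  \<open>B\<close> moves past both resolvents, which leaves two contractions acting on the fixed
  vector \<open>B x\<close>.\<close>

lemma yosida_domain:
  assumes h: "h \<noteq> 0" and x: "x \<in> D"
  shows "yosida h x = resolvent h (resolvent (- h) (B x))"
proof -
  interpret R: bounded_linear "resolvent h"
    by (rule bounded_linear_resolvent[OF h])
  let ?q = "resolvent (- h) x"
  let ?r = "resolvent h ?q"
  have q: "?q \<in> D" "?q + h *\<^sub>R B ?q = x"
    using resolvent[of "- h" x] h by auto
  have r: "?r - h *\<^sub>R B ?r = ?q"
    using resolvent[OF h] by auto
  have "resolvent h x = ?r + h *\<^sub>R B ?r"
    using R.add[of ?q "h *\<^sub>R B ?q"] q B_resolvent[OF h q(1)] by (simp add: R.scaleR)
  then have "resolvent h x - ?q = (2 * h) *\<^sub>R B ?r"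
    using r scaleR_left_distrib[of h h "B ?r"] by (simp add: mult_2 algebra_simps)
  then have "yosida h x = B ?r"
    using h by (simp add: yosida_apply)
  then show ?thesis
    using B_resolvent[OF h q(1)] B_resolvent[of "- h" x] h x by simp
qed

lemma norm_yosida_le:
  assumes "h \<noteq> 0" "x \<in> D"
  shows "norm (yosida h x) \<le> norm (B x)"
  using norm_resolvent_le[of h "resolvent (- h) (B x)"] norm_resolvent_le[of "- h" "B x"] assms
  by (simp add: yosida_domain)

lemma yosida_tendsto:
  assumes h: "filterlim h (at 0) F" and x: "x \<in> D"
  shows "((\<lambda>n. yosida (h n) x) \<longlongrightarrow> B x) F"
proof -
  have h': "filterlim (\<lambda>n. - h n) (at 0) F"
    using h tendsto_minus[of h 0 F] by (auto simp: filterlim_at)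
  have ne: "\<forall>\<^sub>F n in F. h n \<noteq> 0"
    using h by (auto simp: filterlim_at)
  have "((\<lambda>n. norm (resolvent (- h n) (B x) - B x) + norm (resolvent (h n) (B x) - B x)) \<longlongrightarrow> 0) F"
    using resolvent_tendsto[OF h, of "B x"] resolvent_tendsto[OF h', of "B x"]
    by (intro tendsto_add_zero tendsto_norm_zero) (simp_all add: LIM_zero)
  moreover have "\<forall>\<^sub>F n in F. norm (yosida (h n) x - B x) \<le>
      norm (resolvent (- h n) (B x) - B x) + norm (resolvent (h n) (B x) - B x)"
    using ne
  proof eventually_elim
    case (elim n)
    interpret R: bounded_linear "resolvent (h n)"
      by (rule bounded_linear_resolvent[OF elim])
    have "yosida (h n) x - B x = resolvent (h n) (resolvent (- h n) (B x) - B x) +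
        (resolvent (h n) (B x) - B x)"
      by (simp add: yosida_domain[OF elim x] R.diff)
    show ?case
      unfolding \<open>yosida (h n) x - B x = _\<close>
      using norm_resolvent_le[OF elim, of "resolvent (- h n) (B x) - B x"]
        norm_triangle_ineq[of "resolvent (h n) (resolvent (- h n) (B x) - B x)" "resolvent (h n) (B x) - B x"]
      by linarith
  qed
  ultimately have "((\<lambda>n. yosida (h n) x - B x) \<longlongrightarrow> 0) F"
    by (rule Lim_null_comparison[rotated])
  then show ?thesis
    by (simp add: LIM_zero_iff)
qed

section \<open>The limit of the approximating exponentials and its generator\<close>

definition approx :: "nat \<Rightarrow> 'a \<Rightarrow>\<^sub>L 'a" where
  "approx n = yosida (1 / real (Suc n))"

lemma inner_approx: "inner (approx n x) x = 0"
  by (simp add: approx_def inner_yosida)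

lemma norm_approx_le: "x \<in> D \<Longrightarrow> norm (approx n x) \<le> norm (B x)"
  by (simp add: approx_def norm_yosida_le)

lemma approx_tendsto: "x \<in> D \<Longrightarrow> (\<lambda>n. approx n x) \<longlonglongrightarrow> B x"
  unfolding approx_def
  by (rule yosida_tendsto) (auto simp: filterlim_at intro: lim_1_over_n[THEN LIMSEQ_Suc, simplified])

lemma norm_expo_approx [simp]: "norm (expo (approx n) t x) = norm x"
  by (simp add: norm_expo inner_approx)

text \<open>The approximations commute, so one exponential is the other times the exponential of
  their difference \<open>?C\<close>. The common factor is an isometry and drops out;
  \<open>?C\<close> is skew again, so its orbit through \<open>x\<close> moves with constant speed
  norm of \<open>?C x\<close>.\<close>

lemma expo_approx_diff_le:
  "norm (expo (approx m) t x - expo (approx n) t x) \<le> \<bar>t\<bar> * norm (approx m x - approx n x)"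
proof -
  let ?C = "approx m - approx n"
  have C: "inner (?C y) y = 0" for y
    by (simp add: blinfun.bilinear_simps inner_diff_left inner_approx)
  have comm: "approx n o\<^sub>L ?C = ?C o\<^sub>L approx n"
  proof (rule blinfun_eqI)
    fix y
    have "(approx n o\<^sub>L approx m) y = (approx m o\<^sub>L approx n) y"
      unfolding approx_def by (subst yosida_commute) auto
    then show "(approx n o\<^sub>L ?C) y = (?C o\<^sub>L approx n) y"
      by (simp add: blinfun.bilinear_simps)
  qed
  have "expo (approx m) t x = expo (approx n) t (expo ?C t x)"
    using expo_add[OF comm, of t x] by simp
  then have "norm (expo (approx m) t x - expo (approx n) t x) = norm (expo ?C t x - x)"
    by (metis blinfun.diff_right norm_expo_approx)
  also have "\<dots> \<le> \<bar>t\<bar> * norm (?C x)"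
    using norm_expo_diff_le[of t ?C x 0 "norm (?C x)"] by (simp add: norm_expo C)
  finally show ?thesis
    by (simp add: blinfun.bilinear_simps)
qed

definition group :: "real \<Rightarrow> 'a \<Rightarrow> 'a" where
  "group t x = lim (\<lambda>n. expo (approx n) t x)"

lemma expo_approx_tendsto: "(\<lambda>n. expo (approx n) t x) \<longlonglongrightarrow> group t x"
proof -
  have "Cauchy (\<lambda>n. expo (approx n) t x)"
  proof (rule isometry_Cauchy_dense[OF _ _ dense_D])
    show "linear (expo (approx n) t)" for n
      by (intro bounded_linear.linear blinfun.bounded_linear_right)
    fix y
    assume y: "y \<in> D"
    have "Cauchy (\<lambda>n. approx n y)"
      using approx_tendsto[OF y] by (rule LIMSEQ_imp_Cauchy)
    show "Cauchy (\<lambda>n. expo (approx n) t y)"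
    proof (rule metric_CauchyI)
      fix e :: real
      assume e: "0 < e"
      \<comment> \<open>The added 1 avoids a division by zero at \<open>t\<close> = 0.\<close>
      obtain M where M: "\<And>m n. m \<ge> M \<Longrightarrow> n \<ge> M \<Longrightarrow> dist (approx m y) (approx n y) < e / (\<bar>t\<bar> + 1)"
        using metric_CauchyD[OF \<open>Cauchy (\<lambda>n. approx n y)\<close>, of "e / (\<bar>t\<bar> + 1)"] e by auto
      have "dist (expo (approx m) t y) (expo (approx n) t y) < e" if "m \<ge> M" "n \<ge> M" for m n
      proof -
        have "dist (expo (approx m) t y) (expo (approx n) t y) \<le> \<bar>t\<bar> * norm (approx m y - approx n y)"
          using expo_approx_diff_le by (simp add: dist_norm)
        also have "\<dots> \<le> (\<bar>t\<bar> + 1) * norm (approx m y - approx n y)"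
          by (simp add: mult_right_mono)
        also have "\<dots> < e"
          using M[OF that] by (simp add: dist_norm field_simps)
        finally show ?thesis .
      qed
      then show "\<exists>M. \<forall>m\<ge>M. \<forall>n\<ge>M. dist (expo (approx m) t y) (expo (approx n) t y) < e"
        by blast
    qed
  qed simp
  then show ?thesis
    by (simp add: group_def Cauchy_convergent_iff convergent_LIMSEQ_iff)
qed

lemma norm_group: "norm (group t x) = norm x"
  using tendsto_norm[OF expo_approx_tendsto[of t x]] by (simp add: LIMSEQ_const_iff)

lemma bounded_linear_group: "bounded_linear (group t)"
proof (rule bounded_linear_intro)
  show "group t (x + y) = group t x + group t y" for x y
    using tendsto_add[OF expo_approx_tendsto[of t x] expo_approx_tendsto[of t y]]
      LIMSEQ_unique expo_approx_tendsto[of t "x + y"] by (simp add: blinfun.bilinear_simps) blast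
  show "group t (c *\<^sub>R x) = c *\<^sub>R group t x" for c x
    using tendsto_scaleR[OF tendsto_const expo_approx_tendsto[of t x], of c]
      LIMSEQ_unique expo_approx_tendsto[of t "c *\<^sub>R x"] by (simp add: blinfun.bilinear_simps) blast
  show "norm (group t x) \<le> norm x * 1" for x
    by (simp add: norm_group)
qed

lemma group_plus: "group (s + t) x = group s (group t x)"
proof -
  \<comment> \<open>Operator and argument vary together; isometry allows replacing the inner
    exponential by its limit.\<close>
  have "(\<lambda>n. expo (approx n) s (expo (approx n) t x - group t x)) \<longlonglongrightarrow> 0"
    using expo_approx_tendsto[of t x]
    by (subst tendsto_norm_zero_iff[symmetric]) (simp add: LIM_zero tendsto_norm_zero)
  from tendsto_add[OF this expo_approx_tendsto[of s "group t x"]]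
  have "(\<lambda>n. expo (approx n) (s + t) x) \<longlonglongrightarrow> group s (group t x)"
    by (simp add: blinfun.bilinear_simps expo_plus)
  then show ?thesis
    using LIMSEQ_unique expo_approx_tendsto by blast
qed

text \<open>The bound is uniform in \<open>n\<close> and allows \<open>x\<close> outside the domain:
  \<open>x\<close> is compared with some \<open>y\<close> in the domain, whose orbits move with
  speed at most the norm of \<open>B y\<close>.\<close>

lemma expo_approx_near_le:
  assumes "y \<in> D"
  shows "norm (expo (approx n) t x - x) \<le> 2 * norm (x - y) + \<bar>t\<bar> * norm (B y)"
proof -
  let ?E = "expo (approx n) t"
  have "norm (?E y - y) \<le> \<bar>t\<bar> * norm (approx n y)"
    using norm_expo_diff_le[of t "approx n" y 0 "norm (approx n y)"] by simp
  also have "\<dots> \<le> \<bar>t\<bar> * norm (B y)"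
    using norm_approx_le[OF assms] by (simp add: mult_left_mono)
  finally have "norm (?E y - y) \<le> \<bar>t\<bar> * norm (B y)" .
  moreover have "?E x - x = ?E (x - y) + (?E y - y) + (y - x)"
    by (simp add: blinfun.bilinear_simps)
  then have "norm (?E x - x) \<le> norm (?E (x - y)) + norm (?E y - y) + norm (y - x)"
    using norm_triangle_ineq[of "?E (x - y) + (?E y - y)" "y - x"]
      norm_triangle_ineq[of "?E (x - y)" "?E y - y"] by simp
  ultimately show ?thesis
    by (simp add: norm_minus_commute)
qed

text \<open>\<open>B x\<close> may lie outside the domain, so its displacement under the
  approximating exponentials is measured through a nearby \<open>y\<close> in the domain. The
  estimate holds for each \<open>n\<close> up to norm of \<open>approx n x - B x\<close>, which
  vanishes in the limit.\<close>

lemma group_diff_quotient_le: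
  assumes x: "x \<in> D" and y: "y \<in> D"
  shows "norm (group t x - x - t *\<^sub>R B x) \<le> \<bar>t\<bar> * (2 * norm (B x - y) + \<bar>t\<bar> * norm (B y))"
proof (rule LIMSEQ_le)
  show "(\<lambda>n. norm (expo (approx n) t x - x - t *\<^sub>R B x)) \<longlonglongrightarrow> norm (group t x - x - t *\<^sub>R B x)"
    by (intro tendsto_intros expo_approx_tendsto)
  have "(\<lambda>n. \<bar>t\<bar> * (norm (approx n x - B x) + (2 * norm (B x - y) + \<bar>t\<bar> * norm (B y))))
      \<longlonglongrightarrow> \<bar>t\<bar> * (norm (B x - B x) + (2 * norm (B x - y) + \<bar>t\<bar> * norm (B y)))"
    by (intro tendsto_intros approx_tendsto x)
  then show "(\<lambda>n. \<bar>t\<bar> * (norm (approx n x - B x) + (2 * norm (B x - y) + \<bar>t\<bar> * norm (B y))))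
      \<longlonglongrightarrow> \<bar>t\<bar> * (2 * norm (B x - y) + \<bar>t\<bar> * norm (B y))"
    by simp
  have "norm (expo (approx n) t x - x - t *\<^sub>R B x) \<le>
      \<bar>t\<bar> * (norm (approx n x - B x) + (2 * norm (B x - y) + \<bar>t\<bar> * norm (B y)))" for n
  proof (rule norm_expo_diff_le)
    fix s
    assume s: "\<bar>s\<bar> \<le> \<bar>t\<bar>"
    let ?E = "expo (approx n) s"
    have eq: "?E (approx n x) - B x = ?E (approx n x - B x) + (?E (B x) - B x)"
      by (simp add: blinfun.bilinear_simps)
    have "norm (?E (approx n x) - B x) \<le> norm (approx n x - B x) + norm (?E (B x) - B x)"
      using norm_triangle_ineq[of "?E (approx n x - B x)" "?E (B x) - B x"]
      by (simp only: eq norm_expo_approx)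
    also have "norm (?E (B x) - B x) \<le> 2 * norm (B x - y) + \<bar>s\<bar> * norm (B y)"
      by (rule expo_approx_near_le[OF y])
    also have "\<bar>s\<bar> * norm (B y) \<le> \<bar>t\<bar> * norm (B y)"
      using s by (simp add: mult_right_mono)
    finally show "norm (?E (approx n x) - B x) \<le>
        norm (approx n x - B x) + (2 * norm (B x - y) + \<bar>t\<bar> * norm (B y))"
      by simp
  qed
  then show "\<exists>N. \<forall>n\<ge>N. norm (expo (approx n) t x - x - t *\<^sub>R B x) \<le>
      \<bar>t\<bar> * (norm (approx n x - B x) + (2 * norm (B x - y) + \<bar>t\<bar> * norm (B y)))"
    by blast
qed

lemma group_has_generator:
  assumes x: "x \<in> D"
  shows "((\<lambda>h. (group h x - x) /\<^sub>R h) \<longlongrightarrow> B x) (at 0)"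
proof (rule tendstoI)
  fix e :: real
  assume e: "0 < e"
  \<comment> \<open>This distance enters the bound with factor 2, hence e/4 here and e/2 for the
    term with \<open>B y\<close>.\<close>
  obtain y where y: "y \<in> D" "dist y (B x) < e / 4"
    using dense_D e by (metis UNIV_I closure_approachable divide_pos_pos zero_less_numeral)
  have "((\<lambda>h. \<bar>h\<bar> * norm (B y)) \<longlongrightarrow> \<bar>0\<bar> * norm (B y)) (at 0)"
    by (intro tendsto_intros)
  then have "\<forall>\<^sub>F h in at 0. \<bar>h\<bar> * norm (B y) < e / 2"
    using e by (intro order_tendstoD) auto
  moreover have "\<forall>\<^sub>F h in at 0. h \<noteq> (0::real)"
    by (simp add: eventually_at_filter)
  ultimately show "\<forall>\<^sub>F h in at 0. dist ((group h x - x) /\<^sub>R h) (B x) < e"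
  proof eventually_elim
    case (elim h)
    have "(group h x - x) /\<^sub>R h - B x = (group h x - x - h *\<^sub>R B x) /\<^sub>R h"
      using elim by (simp add: scaleR_diff_right)
    then have "dist ((group h x - x) /\<^sub>R h) (B x) = norm (group h x - x - h *\<^sub>R B x) / \<bar>h\<bar>"
      by (simp add: dist_norm divide_inverse)
    also have "\<dots> \<le> 2 * norm (B x - y) + \<bar>h\<bar> * norm (B y)"
      using group_diff_quotient_le[OF x y(1), of h] elim by (simp add: field_simps)
    also have "\<dots> < e"
      using elim y(2) by (simp add: dist_norm norm_minus_commute)
    finally show ?case .
  qed
qed

lemma group_continuous: "((\<lambda>t. group t x) \<longlongrightarrow> x) (at 0)"
proof (rule contraction_tendsto_dense[OF _ _ dense_D])
  show "linear (group t)" for t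
    by (rule bounded_linear.linear[OF bounded_linear_group])
  show "norm (group t x) \<le> norm x" for t x
    by (simp add: norm_group)
  fix y
  assume y: "y \<in> D"
  have "((\<lambda>h. h *\<^sub>R ((group h y - y) /\<^sub>R h)) \<longlongrightarrow> 0) (at 0)"
    using tendsto_scaleR[OF tendsto_ident_at group_has_generator[OF y]]
    by (simp only: scaleR_zero_left)
  then have "((\<lambda>h. group h y - y) \<longlongrightarrow> 0) (at 0)"
    by (rule Lim_transform_eventually) (auto simp: eventually_at_filter)
  then show "((\<lambda>t. group t y) \<longlongrightarrow> y) (at 0)"
    by (simp add: LIM_zero_iff)
qed

text \<open>
  A generator extending \<^term>\<open>B\<close> is itself skew because the group is isometric, and \<^term>\<open>B\<close> has no
  proper skew extension because the range of \<^term>\<open>\<lambda>x. x - B x\<close> is everything.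
\<close>

lemma generator_group_domain:
  assumes "((\<lambda>h. (group h x - x) /\<^sub>R h) \<longlongrightarrow> y) (at 0)"
  shows "x \<in> D"
proof -
  \<comment> \<open>\<open>x'\<close> is chosen so that \<open>x - x'\<close> becomes an eigenvector
    of the generator of \<open>group\<close> with eigenvalue 1, which an isometric group does not
    admit unless it is 0.\<close>
  obtain x' where x': "x' \<in> D" "x' - 1 *\<^sub>R B x' = x - y"
    using range[of 1] by auto
  let ?z = "x - x'"
  have "((\<lambda>h. (group h x - x) /\<^sub>R h - (group h x' - x') /\<^sub>R h) \<longlongrightarrow> y - B x') (at 0)"
    using assms group_has_generator[OF x'(1)] by (rule tendsto_diff)
  moreover have "(group h x - x) /\<^sub>R h - (group h x' - x') /\<^sub>R h = (group h ?z - ?z) /\<^sub>R h" for h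
    by (simp add: linear_diff[OF bounded_linear.linear[OF bounded_linear_group]] algebra_simps)
  moreover have "y - B x' = ?z"
    using x'(2) by (simp add: algebra_simps)
  ultimately have lim: "((\<lambda>h. (group h ?z - ?z) /\<^sub>R h) \<longlongrightarrow> ?z) (at 0)"
    by simp
  \<comment> \<open>The inner product is the difference of two equal squared norms divided by
    \<open>h\<close>, hence 0, while its limit is twice the squared norm of
    \<open>?z\<close>.\<close>
  have "((\<lambda>h. inner ((group h ?z - ?z) /\<^sub>R h) (group h ?z + ?z)) \<longlongrightarrow> inner ?z (?z + ?z)) (at 0)"
    by (intro tendsto_intros lim group_continuous)
  moreover have "inner ((group h ?z - ?z) /\<^sub>R h) (group h ?z + ?z) = 0" for h
  proof -
    have "inner (a - b) (a + b) = 0" if "norm a = norm b" for a b :: 'a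
      using that
      by (simp add: inner_diff_left inner_diff_right inner_add_left inner_add_right inner_commute norm_eq_sqrt_inner)
    from this[OF norm_group[of h ?z]] show ?thesis
      by simp
  qed
  ultimately have "((\<lambda>h::real. 0::real) \<longlongrightarrow> inner ?z (?z + ?z)) (at 0)"
    by (simp only:)
  then have "inner ?z (?z + ?z) = 0"
    using LIM_const_eq by metis
  then have "?z = 0"
    by (simp add: inner_add_right)
  then show ?thesis
    using x'(1) by simp
qed

theorem generated_group_group: "generated_group D B group"
proof (intro generated_group.intro generated_group_axioms.intro)
  show "skew_operator D B"
    by unfold_locales
  show "bounded_linear (group t)" for t
    by (rule bounded_linear_group)
  show "group 0 x = x" for x
    using expo_approx_tendsto[of 0 x] by (simp add: LIMSEQ_const_iff)
  show "group (s + t) x = group s (group t x)" for s t x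
    by (rule group_plus)
  show "((\<lambda>t. group t x) \<longlongrightarrow> x) (at 0)" for x
    by (rule group_continuous)
  show "((\<lambda>h. (group h x - x) /\<^sub>R h) \<longlongrightarrow> y) (at 0) \<longleftrightarrow> x \<in> D \<and> y = B x" for x y
    using generator_group_domain group_has_generator tendsto_unique[OF trivial_limit_at]
    by blast
qed

end

section \<open>Closed skew operators with trivial deficiency\<close>

text \<open>The projection theorem by minimizing the distance: \<open>y\<close> minus the limit of a
  minimizing sequence is orthogonal to \<open>S\<close>, hence 0.\<close>

lemma complete_subspace_eq_UNIV:
  fixes S :: "'a::{real_inner, banach} set"
  assumes sub: "subspace S" and cl: "closed S"
    and orth: "\<And>z. (\<And>x. x \<in> S \<Longrightarrow> inner x z = 0) \<Longrightarrow> z = 0"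
  shows "S = UNIV"
proof -
  have "y \<in> S" for y
  proof -
    define d where "d = infdist y S"
    have S0: "S \<noteq> {}"
      using subspace_0[OF sub] by auto
    have d_le: "d \<le> norm (y - x)" if "x \<in> S" for x
      using infdist_le[OF that, of y] by (simp add: d_def dist_norm)
    have d0: "0 \<le> d"
      by (simp add: d_def infdist_nonneg)
    have ex: "\<exists>x\<in>S. norm (y - x) < d + e" if "0 < e" for e
    proof (rule ccontr)
      assume "\<not> ?thesis"
      then have "d + e \<le> infdist y S"
        unfolding infdist_notempty[OF S0] by (intro cINF_greatest S0) (auto simp: dist_norm not_less)
      then show False
        using that by (simp add: d_def)
    qed
    then have "\<forall>n. \<exists>x. x \<in> S \<and> norm (y - x) < d + 1 / real (Suc n)"
      by (metis of_nat_0_less_iff zero_less_Suc zero_less_divide_1_iff)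
    then obtain s where s: "\<And>n. s n \<in> S" "\<And>n. norm (y - s n) < d + 1 / real (Suc n)"
      by metis
    have s_lim: "(\<lambda>n. norm (y - s n)) \<longlonglongrightarrow> d"
    proof (rule tendsto_sandwich)
      show "\<forall>\<^sub>F n in sequentially. d \<le> norm (y - s n)"
        by (intro always_eventually allI d_le s(1))
      show "(\<lambda>n. d + 1 / real (Suc n)) \<longlonglongrightarrow> d"
        using tendsto_add[OF tendsto_const[of d] LIMSEQ_Suc[OF lim_1_over_n]] by simp
      show "\<forall>\<^sub>F n in sequentially. norm (y - s n) \<le> d + 1 / real (Suc n)"
        using s(2) by (intro always_eventually allI less_imp_le)
    qed simp
    \<comment> \<open>The midpoint of \<open>s m\<close> and \<open>s n\<close> lies in
      \<open>S\<close>, so its distance to \<open>y\<close> is at least \<open>d\<close>; the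
      parallelogram law turns this into a bound on \<open>s m - s n\<close>.\<close>
    have para: "(norm (s m - s n))\<^sup>2 \<le> 2 * (norm (y - s m))\<^sup>2 + 2 * (norm (y - s n))\<^sup>2 - 4 * d\<^sup>2" for m n
    proof -
      have "(1 / 2) *\<^sub>R (s m + s n) \<in> S"
        using s(1) sub by (intro subspace_scale subspace_add)
      then have "d\<^sup>2 \<le> (norm (y - (1 / 2) *\<^sub>R (s m + s n)))\<^sup>2"
        using d0 by (intro power_mono d_le)
      also have "\<dots> = (1 / 4) * (norm ((y - s m) + (y - s n)))\<^sup>2"
      proof -
        have "y - (1 / 2) *\<^sub>R (s m + s n) = (1 / 2) *\<^sub>R ((y - s m) + (y - s n))"
          by (simp add: algebra_simps scaleR_add_left[symmetric] flip: scaleR_2)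
        then show ?thesis
          by (simp add: power2_eq_square)
      qed
      finally have "4 * d\<^sup>2 \<le> (norm ((y - s m) + (y - s n)))\<^sup>2"
        by simp
      moreover have "(norm (a + b))\<^sup>2 + (norm (a - b))\<^sup>2 = 2 * (norm a)\<^sup>2 + 2 * (norm b)\<^sup>2" for a b :: 'a
        by (simp add: power2_norm_eq_inner inner_add_left inner_add_right inner_diff_left inner_diff_right)
      from this[of "y - s m" "y - s n"]
      have "(norm ((y - s m) + (y - s n)))\<^sup>2 + (norm (s n - s m))\<^sup>2 =
          2 * (norm (y - s m))\<^sup>2 + 2 * (norm (y - s n))\<^sup>2"
        by simp
      ultimately show ?thesis
        by (simp add: norm_minus_commute[of "s m"])
    qed
    have "Cauchy s"
    proof (rule metric_CauchyI)
      fix e :: real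
      assume e: "0 < e"
      have "(\<lambda>n. (norm (y - s n))\<^sup>2) \<longlonglongrightarrow> d\<^sup>2"
        by (intro tendsto_intros s_lim)
      then have "\<forall>\<^sub>F n in sequentially. (norm (y - s n))\<^sup>2 < d\<^sup>2 + e\<^sup>2 / 4"
        using e by (intro order_tendstoD) auto
      then obtain M where M: "\<And>n. n \<ge> M \<Longrightarrow> (norm (y - s n))\<^sup>2 < d\<^sup>2 + e\<^sup>2 / 4"
        by (auto simp: eventually_sequentially)
      have "dist (s m) (s n) < e" if "m \<ge> M" "n \<ge> M" for m n
      proof -
        have "(norm (s m - s n))\<^sup>2 < e\<^sup>2"
          using para[of m n] M[OF that(1)] M[OF that(2)] by linarith
        then show ?thesis
          using e by (simp add: dist_norm power_less_imp_less_base)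
      qed
      then show "\<exists>M. \<forall>m\<ge>M. \<forall>n\<ge>M. dist (s m) (s n) < e"
        by blast
    qed
    then obtain x where x: "s \<longlonglongrightarrow> x"
      by (metis Cauchy_convergent convergent_def)
    then have xS: "x \<in> S"
      using cl s(1) by (metis closed_sequentially)
    have "(\<lambda>n. norm (y - s n)) \<longlonglongrightarrow> norm (y - x)"
      by (intro tendsto_intros x)
    then have nx: "norm (y - x) = d"
      using s_lim LIMSEQ_unique by blast
    have expand: "(norm (a - t *\<^sub>R b))\<^sup>2 = (norm a)\<^sup>2 - 2 * t * inner a b + t\<^sup>2 * inner b b"
      for a b :: 'a and t
      unfolding power2_norm_eq_inner
      by (simp add: inner_diff_left inner_diff_right inner_commute power2_eq_square)
    have "inner u (y - x) = 0" if u: "u \<in> S" for u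
    proof (cases "u = 0")
      case False
      let ?z = "y - x"
      \<comment> \<open>The minimizer of the quadratic polynomial t -> |z - t u|^2.\<close>
      let ?t = "inner ?z u / inner u u"
      have "x + ?t *\<^sub>R u \<in> S"
        using xS u sub by (intro subspace_scale subspace_add)
      then have "d\<^sup>2 \<le> (norm (y - (x + ?t *\<^sub>R u)))\<^sup>2"
        using d0 by (intro power_mono d_le)
      also have "y - (x + ?t *\<^sub>R u) = ?z - ?t *\<^sub>R u"
        by simp
      also have "(norm (?z - ?t *\<^sub>R u))\<^sup>2 = (norm ?z)\<^sup>2 - 2 * ?t * inner ?z u + ?t\<^sup>2 * inner u u"
        by (rule expand)
      also have "\<dots> = d\<^sup>2 - (inner ?z u)\<^sup>2 / inner u u"
        using False unfolding nx by (simp add: power2_eq_square)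
      finally have "(inner ?z u)\<^sup>2 / inner u u \<le> 0"
        by simp
      then have "inner ?z u = 0"
        using False by (simp add: pos_divide_le_eq[of "inner u u"])
      then show ?thesis
        by (metis inner_commute)
    qed simp
    then have "y - x = 0"
      by (rule orth)
    then show ?thesis
      using xS by simp
  qed
  then show ?thesis
    by auto
qed

context skew_operator
begin

text \<open>By \<open>norm_le_resolvent\<close>, convergent images under 1 - hB have convergent
  preimages, so a closed graph gives a closed range; the deficiency condition leaves it no
  orthogonal complement.\<close>

lemma skew_adjoint_operatorI:
  assumes closed_graph:
      "\<And>X x y. \<lbrakk>\<And>n. X n \<in> D; X \<longlonglongrightarrow> x; (\<lambda>n. B (X n)) \<longlonglongrightarrow> y\<rbrakk> \<Longrightarrow> x \<in> D \<and> B x = y"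
    and deficiency: "\<And>h z. \<lbrakk>h \<noteq> 0; \<And>x. x \<in> D \<Longrightarrow> inner (x - h *\<^sub>R B x) z = 0\<rbrakk> \<Longrightarrow> z = 0"
  shows "skew_adjoint_operator D B"
proof
  fix h :: real and y :: 'a
  assume h: "h \<noteq> 0"
  let ?R = "\<lambda>x. x - h *\<^sub>R B x"
  have diff: "?R (u - v) = ?R u - ?R v" if "u \<in> D" "v \<in> D" for u v
    using that by (simp add: B_diff algebra_simps)
  have "?R ` D = UNIV"
  proof (rule complete_subspace_eq_UNIV)
    show "subspace (?R ` D)"
    proof (rule subspaceI)
      have "?R 0 = 0"
        using B_scaleR[of 0 0] by simp
      then show "0 \<in> ?R ` D"
        using image_eqI[of 0 ?R 0 D] by simp
      fix u v c
      assume u: "u \<in> ?R ` D" and v: "v \<in> ?R ` D"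
      then obtain u' v' where u': "u' \<in> D" "u = ?R u'" and v': "v' \<in> D" "v = ?R v'"
        by blast
      have "?R (u' + v') = u + v" "?R (c *\<^sub>R u') = c *\<^sub>R u"
        unfolding u'(2) v'(2) using u'(1) v'(1) by (simp_all add: B_add B_scaleR algebra_simps)
      then show "u + v \<in> ?R ` D" "c *\<^sub>R u \<in> ?R ` D"
        using image_eqI[of "u + v" ?R "u' + v'" D] image_eqI[of "c *\<^sub>R u" ?R "c *\<^sub>R u'" D] u'(1) v'(1)
        by simp_all
    qed
    show "z = 0" if "\<And>x. x \<in> ?R ` D \<Longrightarrow> inner x z = 0" for z
      using deficiency[OF h] that by blast
    show "closed (?R ` D)"
      unfolding closed_sequential_limits
    proof (intro allI impI, elim conjE)
      fix f l
      assume "\<forall>n. f n \<in> ?R ` D" and l: "f \<longlonglongrightarrow> l"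
      then have "\<forall>n. \<exists>x. x \<in> D \<and> f n = ?R x"
        by blast
      then obtain X where X: "\<And>n. X n \<in> D" "\<And>n. f n = ?R (X n)"
        using choice[of "\<lambda>n x. x \<in> D \<and> f n = ?R x"] by auto
      have "norm (X m - X n) \<le> norm (f m - f n)" for m n
        using norm_le_resolvent[of "X m - X n" h] X diff by simp
      then have "Cauchy X"
        using LIMSEQ_imp_Cauchy[OF l] unfolding Cauchy_def dist_norm by (meson le_less_trans)
      then obtain x where x: "X \<longlonglongrightarrow> x"
        by (metis Cauchy_convergent convergent_def)
      have "(\<lambda>n. (1 / h) *\<^sub>R (X n - f n)) \<longlonglongrightarrow> (1 / h) *\<^sub>R (x - l)"
        by (intro tendsto_intros x l)
      moreover have "(1 / h) *\<^sub>R (X n - f n) = B (X n)" for n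
        using h by (simp add: X(2))
      ultimately have "x \<in> D \<and> B x = (1 / h) *\<^sub>R (x - l)"
        using closed_graph[OF X(1) x] by simp
      then have "x \<in> D" "l = ?R x"
        using h by auto
      then show "l \<in> ?R ` D"
        by blast
    qed
  qed
  then have "y \<in> ?R ` D"
    by simp
  then show "\<exists>x\<in>D. ?R x = y"
    by blast
qed

end

section \<open>The Hilbert space of square summable sequences\<close>

lemma ell2_zero_index: "f \<in> ell2 \<Longrightarrow> f 0 = 0"
  by (simp add: ell2_def)

lemma ell2_summable: "f \<in> ell2 \<Longrightarrow> summable (\<lambda>n. (cmod (f n))\<^sup>2)"
  by (simp add: ell2_def)

lemma ell2_bounded_partial_sums:
  assumes "f 0 = 0" "0 \<le> c" "\<And>N. (\<Sum>n<N. (cmod (f n))\<^sup>2) \<le> c\<^sup>2"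
  shows "f \<in> ell2" "ell2_norm f \<le> c"
proof -
  have s: "summable (\<lambda>n. (cmod (f n))\<^sup>2)"
    using assms(3) by (intro summableI_nonneg_bounded) auto
  then show "f \<in> ell2"
    using assms(1) by (simp add: ell2_def)
  have "(\<Sum>n. (cmod (f n))\<^sup>2) \<le> c\<^sup>2"
    using s assms(3) by (rule suminf_le_const)
  then show "ell2_norm f \<le> c"
    unfolding ell2_norm_def using assms(2) by (metis real_le_lsqrt real_sqrt_unique real_sqrt_le_mono)
qed

lemma ell2_add:
  assumes "f \<in> ell2" "g \<in> ell2"
  shows "(\<lambda>n. f n + g n) \<in> ell2"
proof -
  have "(cmod (f n + g n))\<^sup>2 \<le> 2 * (cmod (f n))\<^sup>2 + 2 * (cmod (g n))\<^sup>2" for n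
  proof -
    have "(cmod (f n + g n))\<^sup>2 \<le> (cmod (f n) + cmod (g n))\<^sup>2"
      by (simp add: norm_triangle_ineq)
    also have "\<dots> \<le> 2 * (cmod (f n))\<^sup>2 + 2 * (cmod (g n))\<^sup>2"
      using sum_squares_bound[of "cmod (f n)" "cmod (g n)"] by (simp add: power2_sum)
    finally show ?thesis .
  qed
  moreover have "summable (\<lambda>n. 2 * (cmod (f n))\<^sup>2 + 2 * (cmod (g n))\<^sup>2)"
    using assms by (intro summable_add summable_mult ell2_summable)
  ultimately have "summable (\<lambda>n. (cmod (f n + g n))\<^sup>2)"
    using summable_comparison_test'[of "\<lambda>n. 2 * (cmod (f n))\<^sup>2 + 2 * (cmod (g n))\<^sup>2" 0
        "\<lambda>n. (cmod (f n + g n))\<^sup>2"] by simp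
  then show ?thesis
    using assms by (simp add: ell2_def)
qed

lemma ell2_mult: "f \<in> ell2 \<Longrightarrow> (\<lambda>n. c * f n) \<in> ell2"
  by (simp add: ell2_def norm_mult power_mult_distrib summable_mult)

lemma ell2_cmod_le:
  assumes "f \<in> ell2" "g 0 = 0" "\<And>n. cmod (g n) \<le> cmod (f n)"
  shows "g \<in> ell2"
proof -
  have "summable (\<lambda>n. (cmod (g n))\<^sup>2)"
    by (rule summable_comparison_test'[where N = 0, OF ell2_summable[OF assms(1)]])
      (auto intro: power_mono assms(3))
  then show ?thesis
    using assms(2) by (simp add: ell2_def)
qed

lemma ell2_summable_mult:
  assumes "f \<in> ell2" "g \<in> ell2"
  shows "summable (\<lambda>n. f n * g n)"
proof (rule summable_comparison_test'[where N = 0])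
  show "summable (\<lambda>n. (cmod (f n))\<^sup>2 + (cmod (g n))\<^sup>2)"
    using assms by (intro summable_add ell2_summable)
  show "norm (f n * g n) \<le> (cmod (f n))\<^sup>2 + (cmod (g n))\<^sup>2" for n
    using sum_squares_bound[of "cmod (f n)" "cmod (g n)"] mult_nonneg_nonneg[of "cmod (f n)" "cmod (g n)"]
    unfolding norm_mult by (auto simp del: mult_nonneg_nonneg)
qed

lemma ell2_cnj: "f \<in> ell2 \<Longrightarrow> (\<lambda>n. cnj (f n)) \<in> ell2"
  by (simp add: ell2_def)

lemma ell2_summable_inner:
  assumes "f \<in> ell2" "g \<in> ell2"
  shows "summable (\<lambda>n. inner (f n) (g n))"
  using summable_Re[OF ell2_summable_mult[OF assms(1) ell2_cnj[OF assms(2)]]]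
  by (simp add: inner_complex_def)

section \<open>Square summable sequences as a real Hilbert space\<close>

typedef l2 = ell2
  morphisms seq Abs_l2
proof
  show "(\<lambda>n. 0) \<in> ell2"
    by (simp add: ell2_def)
qed

setup_lifting type_definition_l2

lemma seq_ell2 [simp]: "seq x \<in> ell2"
  by (rule seq)

lemma seq_0 [simp]: "seq x 0 = 0"
  using seq_ell2 by (rule ell2_zero_index)

instantiation l2 :: real_inner
begin

lift_definition zero_l2 :: l2 is "\<lambda>n. 0"
  by (simp add: ell2_def)

lift_definition plus_l2 :: "l2 \<Rightarrow> l2 \<Rightarrow> l2" is "\<lambda>f g n. f n + g n"
  by (rule ell2_add)

lift_definition scaleR_l2 :: "real \<Rightarrow> l2 \<Rightarrow> l2" is "\<lambda>r f n. r *\<^sub>R f n"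
  by (simp add: scaleR_conv_of_real ell2_mult)

lift_definition uminus_l2 :: "l2 \<Rightarrow> l2" is "\<lambda>f n. - f n"
  by (simp add: ell2_def)

definition minus_l2 :: "l2 \<Rightarrow> l2 \<Rightarrow> l2" where
  "minus_l2 x y = x + - y"

text \<open>On complex entries \<open>inner\<close> is the real part of z times the conjugate of w.
  Complex orthogonality to a vector therefore becomes two real conditions, against the vector and
  against \<i> times it.\<close>

definition inner_l2 :: "l2 \<Rightarrow> l2 \<Rightarrow> real" where
  "inner_l2 x y = (\<Sum>n. inner (seq x n) (seq y n))"

definition norm_l2 :: "l2 \<Rightarrow> real" where
  "norm_l2 x = sqrt (inner x x)"

definition sgn_l2 :: "l2 \<Rightarrow> l2" where
  "sgn_l2 x = inverse (norm x) *\<^sub>R x"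

definition dist_l2 :: "l2 \<Rightarrow> l2 \<Rightarrow> real" where
  "dist_l2 x y = norm (x - y)"

definition [code del]:
  "(uniformity :: (l2 \<times> l2) filter) = (INF e\<in>{0<..}. principal {(x, y). dist x y < e})"

definition open_l2 :: "l2 set \<Rightarrow> bool"
  where [code del]:
    "open_l2 S = (\<forall>x\<in>S. \<forall>\<^sub>F (x', y) in uniformity. x' = x \<longrightarrow> y \<in> S)"

instance
proof
  fix x y z :: l2 and r s :: real
  show "x + y + z = x + (y + z)" "x + y = y + x" "0 + x = x" "- x + x = 0"
    "r *\<^sub>R (x + y) = r *\<^sub>R x + r *\<^sub>R y" "(r + s) *\<^sub>R x = r *\<^sub>R x + s *\<^sub>R x"
    "r *\<^sub>R s *\<^sub>R x = (r * s) *\<^sub>R x" "1 *\<^sub>R x = x"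
    by (transfer, simp add: algebra_simps)+
  show "x - y = x + - y"
    by (rule minus_l2_def)
  show "sgn x = inverse (norm x) *\<^sub>R x"
    by (rule sgn_l2_def)
  show "dist x y = norm (x - y)"
    by (rule dist_l2_def)
  show "(uniformity :: (l2 \<times> l2) filter) = (INF e\<in>{0<..}. principal {(x, y). dist x y < e})"
    by (rule uniformity_l2_def)
  show "open S = (\<forall>x\<in>S. \<forall>\<^sub>F (x', y) in uniformity. x' = x \<longrightarrow> y \<in> S)" for S :: "l2 set"
    by (rule open_l2_def)
  show "norm x = sqrt (inner x x)"
    by (rule norm_l2_def)
  show "inner x y = inner y x"
    by (simp add: inner_l2_def inner_commute)
  have s: "summable (\<lambda>n. inner (seq x n) (seq y n))" for x y
    by (simp add: ell2_summable_inner)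
  show "inner (x + y) z = inner x z + inner y z"
    using s[of x z] s[of y z]
    by (simp add: inner_l2_def plus_l2.rep_eq inner_add_left suminf_add)
  show "inner (r *\<^sub>R x) y = r * inner x y"
    using s[of x y] by (simp add: inner_l2_def scaleR_l2.rep_eq suminf_mult)
  show "0 \<le> inner x x"
    using s[of x x] by (simp add: inner_l2_def suminf_nonneg)
  show "inner x x = 0 \<longleftrightarrow> x = 0"
    using suminf_eq_zero_iff[OF s[of x x]]
    by (auto simp: inner_l2_def seq_inject[symmetric] zero_l2.rep_eq)
qed

end

lemma seq_simps [simp]:
  "seq 0 n = 0" "seq (x + y) n = seq x n + seq y n" "seq (r *\<^sub>R x) n = r *\<^sub>R seq x n"
  "seq (- x) n = - seq x n" "seq (x - y) n = seq x n - seq y n"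
proof -
  have "seq (x + - y) n = seq x n + - seq y n"
    by (simp only: plus_l2.rep_eq uminus_l2.rep_eq)
  then show "seq (x - y) n = seq x n - seq y n"
    by simp
qed (simp_all add: zero_l2.rep_eq plus_l2.rep_eq scaleR_l2.rep_eq uminus_l2.rep_eq)

lemma l2_eqI: "(\<And>n. seq x n = seq y n) \<Longrightarrow> x = y"
  by (simp add: seq_inject[symmetric] fun_eq_iff)

lemma seq_Abs_l2 [simp]: "f \<in> ell2 \<Longrightarrow> seq (Abs_l2 f) = f"
  by (rule Abs_l2_inverse)

lemma ell2_norm_seq: "ell2_norm (seq x) = norm x"
  by (simp add: ell2_norm_def norm_eq_sqrt_inner inner_l2_def power2_norm_eq_inner)

lemma norm_seq_le: "cmod (seq x n) \<le> norm x"
proof -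
  have "(\<Sum>k\<in>{n}. (cmod (seq x k))\<^sup>2) \<le> (\<Sum>k. (cmod (seq x k))\<^sup>2)"
    by (intro sum_le_suminf ell2_summable) auto
  then show ?thesis
    by (simp add: ell2_norm_seq[symmetric] ell2_norm_def real_le_rsqrt)
qed

lemma bounded_linear_seq: "bounded_linear (\<lambda>x. seq x n)"
  by (rule bounded_linear_intro[where K = 1]) (auto simp: norm_seq_le)

lemma inner_l2_complex: "inner x y = Re (\<Sum>n. seq x n * cnj (seq y n))"
  using ell2_summable_mult[OF seq_ell2 ell2_cnj[OF seq_ell2], of x y]
  by (simp add: inner_l2_def inner_complex_def bounded_linear.suminf[OF bounded_linear_Re])

instance l2 :: banach
proof
  fix X :: "nat \<Rightarrow> l2"
  assume X: "Cauchy X"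
  have "Cauchy (\<lambda>m. seq (X m) n)" for n
    using bounded_linear.Cauchy[OF bounded_linear_seq X] .
  then have "\<exists>L. \<forall>n. (\<lambda>m. seq (X m) n) \<longlonglongrightarrow> L n"
    by (intro choice) (simp add: Cauchy_convergent_iff convergent_def)
  then obtain L where L: "\<And>n. (\<lambda>m. seq (X m) n) \<longlonglongrightarrow> L n"
    by blast
  have L0: "L 0 = 0"
    using L[of 0] by (simp add: LIMSEQ_const_iff)
  \<comment> \<open>The Cauchy estimate passes to the limit in the second index on finite partial
    sums only; the uniform bound then covers the full series.\<close>
  have near: "\<exists>M. \<forall>m\<ge>M. (\<lambda>n. seq (X m) n - L n) \<in> ell2 \<and> ell2_norm (\<lambda>n. seq (X m) n - L n) \<le> e"
    if e: "0 < e" for e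
  proof -
    obtain M where M: "\<And>m k. m \<ge> M \<Longrightarrow> k \<ge> M \<Longrightarrow> norm (X m - X k) < e"
      using CauchyD[OF X e] by blast
    have "(\<Sum>n<N. (cmod (seq (X m) n - L n))\<^sup>2) \<le> e\<^sup>2" if m: "m \<ge> M" for m N
    proof (rule LIMSEQ_le_const2)
      show "(\<lambda>k. \<Sum>n<N. (cmod (seq (X m) n - seq (X k) n))\<^sup>2) \<longlonglongrightarrow> (\<Sum>n<N. (cmod (seq (X m) n - L n))\<^sup>2)"
        by (intro tendsto_intros L)
      have "(\<Sum>n<N. (cmod (seq (X m) n - seq (X k) n))\<^sup>2) \<le> e\<^sup>2" if k: "k \<ge> M" for k
      proof -
        have "(\<Sum>n<N. (cmod (seq (X m - X k) n))\<^sup>2) \<le> (\<Sum>n. (cmod (seq (X m - X k) n))\<^sup>2)"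
          by (intro sum_le_suminf ell2_summable seq_ell2) auto
        also have "\<dots> = (norm (X m - X k))\<^sup>2"
          unfolding ell2_norm_seq[symmetric] ell2_norm_def
          by (intro real_sqrt_pow2[symmetric] suminf_nonneg ell2_summable seq_ell2) auto
        also have "\<dots> \<le> e\<^sup>2"
          using M[OF m k] by (intro power_mono) auto
        finally show ?thesis
          by simp
      qed
      then show "\<exists>K. \<forall>k\<ge>K. (\<Sum>n<N. (cmod (seq (X m) n - seq (X k) n))\<^sup>2) \<le> e\<^sup>2"
        by blast
    qed
    then have "\<forall>m\<ge>M. (\<lambda>n. seq (X m) n - L n) \<in> ell2 \<and> ell2_norm (\<lambda>n. seq (X m) n - L n) \<le> e"
      using e L0 by (intro allI impI conjI ell2_bounded_partial_sums[where c = e]) auto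
    then show ?thesis
      by blast
  qed
  obtain M where M: "(\<lambda>n. seq (X M) n - L n) \<in> ell2"
    using near[of 1] by auto
  have "L \<in> ell2"
    using ell2_add[OF seq_ell2[of "X M"] ell2_mult[OF M, of "-1"]] by simp
  then have d: "ell2_norm (\<lambda>n. seq (X m) n - L n) = norm (X m - Abs_l2 L)" for m
  proof -
    have "seq (X m - Abs_l2 L) = (\<lambda>n. seq (X m) n - L n)"
      using \<open>L \<in> ell2\<close> by (simp add: fun_eq_iff)
    then show ?thesis
      by (simp add: ell2_norm_seq[symmetric])
  qed
  have "X \<longlonglongrightarrow> Abs_l2 L"
  proof (rule metric_LIMSEQ_I)
    fix e :: real
    assume "0 < e"
    then show "\<exists>M. \<forall>m\<ge>M. dist (X m) (Abs_l2 L) < e"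
      using near[of "e / 2"] unfolding d dist_norm by force
  qed
  then show "convergent X"
    by (auto simp: convergent_def)
qed

text \<open>The value \<open>c\<close> is a parameter because the inner product is real:
  \<open>c\<close> = 1 and \<open>c\<close> = \<i> read off the real and the imaginary part of an
  entry.\<close>

definition unit :: "nat \<Rightarrow> complex \<Rightarrow> nat \<Rightarrow> complex" where
  "unit k c n = (if n = k then c else 0)"

lemma unit_ell2: "1 \<le> k \<Longrightarrow> unit k c \<in> ell2"
  unfolding ell2_def by (auto simp: unit_def split: if_splits intro!: summable_finite[of "{k}"])

text \<open>Required by the type \<open>operator\<close>, on which the exponential is built.\<close>

instance l2 :: perfect_space
proof
  fix x :: l2
  let ?u = "Abs_l2 (unit 1 1)"
  have u: "?u \<noteq> 0"
    using unit_ell2[of 1 1] by (metis le_refl seq_Abs_l2 seq_simps(1) unit_def zero_neq_one)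
  show "\<not> open {x}"
  proof
    assume "open {x}"
    then obtain e where e: "0 < e" "\<And>y. dist y x < e \<Longrightarrow> y = x"
      by (auto simp: open_dist)
    have "dist (x + (e / (2 * norm ?u)) *\<^sub>R ?u) x < e"
      using e(1) u by (simp add: dist_norm)
    then show False
      using e u by fastforce
  qed
qed

lemma closure_finite_support:
  assumes "\<And>f N. \<lbrakk>f 0 = 0; \<And>n. n \<ge> N \<Longrightarrow> f n = 0\<rbrakk> \<Longrightarrow> Abs_l2 f \<in> D"
  shows "closure D = UNIV"
proof -
  have "x \<in> closure D" for x
    unfolding closure_approachable
  proof (intro allI impI)
    fix e :: real
    assume e: "0 < e"
    then obtain N where N: "\<bar>\<Sum>i. (cmod (seq x (i + N)))\<^sup>2\<bar> < e\<^sup>2"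
      using suminf_exist_split[OF _ ell2_summable[OF seq_ell2], of "e\<^sup>2" x] by auto
    define f where "f n = (if n < N then seq x n else 0)" for n
    have f: "f \<in> ell2"
      by (rule ell2_cmod_le[OF seq_ell2[of x]]) (auto simp: f_def)
    let ?d = "\<lambda>n. (cmod (seq (Abs_l2 f - x) n))\<^sup>2"
    have "suminf ?d = (\<Sum>n. ?d (n + N)) + sum ?d {..<N}"
      by (intro suminf_split_initial_segment ell2_summable seq_ell2)
    also have "\<dots> = (\<Sum>i. (cmod (seq x (i + N)))\<^sup>2)"
      using f by (simp add: f_def)
    finally have "dist (Abs_l2 f) x = sqrt (\<Sum>i. (cmod (seq x (i + N)))\<^sup>2)"
      by (simp add: dist_norm ell2_norm_seq[symmetric] ell2_norm_def)
    also have "\<dots> < e"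
      using N e by (intro real_less_lsqrt) auto
    finally show "\<exists>y\<in>D. dist y x < e"
      using assms[of f N] by (auto simp: f_def)
  qed
  then show ?thesis
    by auto
qed

section \<open>The Jacobi operator in the limit circle case\<close>

lemma weight_0 [simp]: "weight 0 = 0"
  by (simp add: weight_def)

lemma jacobi_at_0 [simp]: "jacobi f 0 = 0"
  by (simp add: jacobi_def)

lemma weight_pos: "0 < weight (Suc n)"
  unfolding weight_def by (intro real_sqrt_gt_zero mult_pos_pos) auto

lemma weight_sq: "(weight n)\<^sup>2 = real n * (real n + 1) * (real n + 2)"
  by (simp add: weight_def)

lemma jacobi_cnj: "jacobi (\<lambda>n. cnj (f n)) k = cnj (jacobi f k)"
  by (simp add: jacobi_def)

section \<open>Wronskians and the two solutions of Js = 0\<close>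

definition wronskian :: "nat \<Rightarrow> (nat \<Rightarrow> complex) \<Rightarrow> (nat \<Rightarrow> complex) \<Rightarrow> complex" where
  "wronskian n f g = of_real (weight n) * (f n * g (n + 1) - f (n + 1) * g n)"

text \<open>Each summand is an increment of the Wronskian. There is no boundary term at the lower
  end since \<open>weight 0\<close> = 0. Both sides are bilinear, without conjugation.\<close>

lemma green: "(\<Sum>k\<le>n. f k * jacobi g k - jacobi f k * g k) = wronskian n f g"
proof (induction n)
  case (Suc n)
  then show ?case
    by (simp add: wronskian_def jacobi_def algebra_simps)
qed (simp add: wronskian_def)

text \<open>The Pluecker relation for the 2 x 2 minors of the matrix with columns (f_n, f_(n+1)) and
  likewise for \<open>g\<close>, \<open>u\<close>, \<open>v\<close>.\<close>

lemma plucker: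
  "wronskian n f g * wronskian n u v =
    wronskian n f u * wronskian n g v - wronskian n f v * wronskian n g u"
  by (simp add: wronskian_def algebra_simps)

text \<open>
  Away from the boundary, $|s_{n+2}|^2 = \frac{n}{n+3}|s_n|^2$ for a solution of $Js=0$, so that
  $|s_n|^2 = (n+1)|s_n|^2 - (n+3)|s_{n+2}|^2$ telescopes.
\<close>

lemma null_solution_summable:
  assumes s: "\<And>n. n \<ge> 2 \<Longrightarrow> jacobi s n = 0"
  shows "summable (\<lambda>n. (cmod (s n))\<^sup>2)"
proof -
  define x where "x n = (cmod (s n))\<^sup>2" for n
  \<comment> \<open>Only row n + 1 >= 2 enters, so the argument also covers
    \<open>second_solution\<close>, for which row 1 fails.\<close>
  have rec: "(real n + 3) * x (n + 2) = real n * x n" if n: "1 \<le> n" for n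
  proof -
    have "of_real (weight (n + 1)) * s (n + 2) = - (of_real (weight n) * s n)"
      using s[of "n + 1"] n by (simp add: jacobi_def eq_neg_iff_add_eq_0)
    then have "(cmod (of_real (weight (n + 1)) * s (n + 2)))\<^sup>2 = (cmod (of_real (weight n) * s n))\<^sup>2"
      by (simp add: norm_mult)
    then have "(weight (n + 1))\<^sup>2 * x (n + 2) = (weight n)\<^sup>2 * x n"
      by (simp add: norm_mult power_mult_distrib x_def)
    then have "((real n + 1) * (real n + 2)) * ((real n + 3) * x (n + 2)) =
        ((real n + 1) * (real n + 2)) * (real n * x n)"
      unfolding weight_sq by (simp add: algebra_simps)
    then show ?thesis
      by (simp only: mult_cancel_left) (auto simp: add_nonneg_eq_0_iff)
  qed
  \<comment> \<open>The left side does not depend on \<open>n\<close>; the right side is its value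
    at 0.\<close>
  have tele: "(\<Sum>k=1..n. x k) + (real n + 2) * x (n + 1) + (real n + 3) * x (n + 2) = 2 * x 1 + 3 * x 2" for n
  proof (induction n)
    case (Suc n)
    have "(real (Suc n) + 3) * x (Suc n + 2) = real (Suc n) * x (Suc n)"
      by (rule rec) simp
    then show ?case
      using Suc by (simp add: algebra_simps)
  qed (simp add: numeral_2_eq_2)
  have "(\<Sum>k<n. x (Suc k)) \<le> 2 * x 1 + 3 * x 2" for n
  proof -
    have "(\<Sum>k<n. x (Suc k)) = (\<Sum>k=1..n. x k)"
      by (simp add: sum.atLeast1_atMost_eq)
    moreover have "0 \<le> (real n + 2) * x (n + 1) + (real n + 3) * x (n + 2)"
      by (simp add: x_def)
    ultimately show ?thesis
      using tele[of n] by linarith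
  qed
  then have "summable (\<lambda>k. x (Suc k))"
    by (intro summableI_nonneg_bounded) (auto simp: x_def)
  then show ?thesis
    using summable_Suc_iff[of x] unfolding x_def by blast
qed

lemma is_null_solution_null_solution: "is_null_solution null_solution"
  unfolding null_solution_def by (rule theI'[OF ex1_null_solution])

lemma null_solution_simps [simp]:
  "null_solution 0 = 0" "null_solution (Suc 0) = 1" "jacobi null_solution n = 0"
  using is_null_solution_null_solution unfolding is_null_solution_def by (cases n; simp)+

lemma cnj_null_solution [simp]: "cnj (null_solution n) = null_solution n"
proof -
  have "is_null_solution (\<lambda>n. cnj (null_solution n))"
    by (simp add: is_null_solution_def jacobi_cnj)
  then have "(\<lambda>n. cnj (null_solution n)) = null_solution"
    using ex1_null_solution is_null_solution_null_solution by blast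
  then show ?thesis
    by metis
qed

lemma null_solution_ell2: "null_solution \<in> ell2"
  by (simp add: ell2_def null_solution_summable)

text \<open>Started with entries 0 and 1 at the indices 1 and 2, hence independent of
  \<open>null_solution\<close>. It satisfies all rows of Js = 0 but the first, where the defect is
  \<open>weight 1\<close>.\<close>

fun second_solution :: "nat \<Rightarrow> complex" where
  "second_solution 0 = 0"
| "second_solution (Suc 0) = 0"
| "second_solution (Suc (Suc n)) =
    (if n = 0 then 1 else - (of_real (weight n) / of_real (weight (Suc n))) * second_solution n)"

lemma jacobi_second_solution:
  "jacobi second_solution n = (if n = 1 then of_real (weight 1) else 0)"
proof (cases n)
  case (Suc m)
  then show ?thesis
    using weight_pos[of m] by (cases m) (auto simp: jacobi_def)
qed simp

lemma second_solution_ell2: "second_solution \<in> ell2"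
  by (simp add: ell2_def null_solution_summable jacobi_second_solution)

lemma wronskian_null_solution:
  "wronskian n null_solution f = (\<Sum>k\<le>n. null_solution k * jacobi f k)"
  by (simp add: green[symmetric])

lemma wronskian_second_solution:
  assumes "1 \<le> n"
  shows "wronskian n second_solution f =
    (\<Sum>k\<le>n. second_solution k * jacobi f k) - of_real (weight 1) * f 1"
proof -
  have "(\<Sum>k\<le>n. jacobi second_solution k * f k) = (\<Sum>k\<le>n. if k = 1 then of_real (weight 1) * f 1 else 0)"
    by (intro sum.cong) (auto simp: jacobi_second_solution)
  also have "\<dots> = of_real (weight 1) * f 1"
    using assms by (subst sum.delta) auto
  finally show ?thesis
    by (simp add: green[symmetric] sum_subtractf)
qed

lemma wronskian_commute: "wronskian n f g = - wronskian n g f"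
  by (simp add: wronskian_def algebra_simps)

text \<open>Both factors being square summable, the Wronskian with \<open>null_solution\<close>
  always has a limit, namely this series; the boundary condition only fixes its value.\<close>

lemma jacobi_domain_iff:
  "f \<in> jacobi_domain \<longleftrightarrow>
    f \<in> ell2 \<and> jacobi f \<in> ell2 \<and> (\<Sum>k. null_solution k * jacobi f k) = 0"
proof -
  have "(\<lambda>n. wronskian n null_solution f) \<longlonglongrightarrow> 0 \<longleftrightarrow> (\<Sum>k. null_solution k * jacobi f k) = 0"
    if "jacobi f \<in> ell2"
  proof -
    have "(\<lambda>n. wronskian n null_solution f) \<longlonglongrightarrow> (\<Sum>k. null_solution k * jacobi f k)"
      unfolding wronskian_null_solution
      by (intro summable_LIMSEQ' ell2_summable_mult null_solution_ell2 that)
    then show ?thesis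
      using LIMSEQ_unique by metis
  qed
  then show ?thesis
    unfolding jacobi_domain_def wronskian_def by auto
qed

lemma jacobi_domain_ell2: "f \<in> jacobi_domain \<Longrightarrow> f \<in> ell2"
  "f \<in> jacobi_domain \<Longrightarrow> jacobi f \<in> ell2"
  by (simp_all add: jacobi_domain_iff)

lemma jacobi_domain_wronskian:
  assumes "f \<in> jacobi_domain"
  shows "(\<lambda>n. wronskian n f null_solution) \<longlonglongrightarrow> 0"
  using assms tendsto_minus[of "\<lambda>n. wronskian n null_solution f" 0]
  unfolding wronskian_commute[of _ f] by (simp add: jacobi_domain_def wronskian_def)

lemma convergent_wronskian_second_solution:
  assumes "f \<in> ell2" "jacobi f \<in> ell2"
  shows "convergent (\<lambda>n. wronskian n f second_solution)"
proof -
  have "(\<lambda>n. \<Sum>k\<le>n. second_solution k * jacobi f k) \<longlonglongrightarrow> (\<Sum>k. second_solution k * jacobi f k)"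
    by (intro summable_LIMSEQ' ell2_summable_mult second_solution_ell2 assms)
  then have "(\<lambda>n. - ((\<Sum>k\<le>n. second_solution k * jacobi f k) - of_real (weight 1) * f 1)) \<longlonglongrightarrow>
      - ((\<Sum>k. second_solution k * jacobi f k) - of_real (weight 1) * f 1)"
    by (intro tendsto_intros)
  then have "(\<lambda>n. wronskian n f second_solution) \<longlonglongrightarrow>
      - ((\<Sum>k. second_solution k * jacobi f k) - of_real (weight 1) * f 1)"
    by (rule Lim_transform_eventually)
      (auto simp: eventually_sequentially wronskian_commute[of _ f] wronskian_second_solution intro!: exI[of _ 1])
  then show ?thesis
    by (auto simp: convergent_def)
qed

lemma jacobi_symmetric:
  assumes f: "f \<in> jacobi_domain" and g: "g \<in> jacobi_domain"
  shows "(\<Sum>k. f k * jacobi g k) = (\<Sum>k. jacobi f k * g k)"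
proof -
  \<comment> \<open>This nonzero constant is the factor W(u, v) by which the relation
    \<open>plucker\<close> is divided.\<close>
  have c: "wronskian n second_solution null_solution = - of_real (weight 1)" if "1 \<le> n" for n
    using wronskian_second_solution[OF that, of null_solution] by simp
  obtain a b where ab: "(\<lambda>n. wronskian n f second_solution) \<longlonglongrightarrow> a"
      "(\<lambda>n. wronskian n g second_solution) \<longlonglongrightarrow> b"
    using convergent_wronskian_second_solution f g jacobi_domain_ell2 by (metis convergent_def)
  have "(\<lambda>n. (wronskian n f second_solution * wronskian n g null_solution -
      wronskian n f null_solution * wronskian n g second_solution) / - of_real (weight 1)) \<longlonglongrightarrow>
      (a * 0 - 0 * b) / - of_real (weight 1)"
    using weight_pos[of 0] by (intro tendsto_intros ab jacobi_domain_wronskian f g) auto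
  then have "(\<lambda>n. wronskian n f g) \<longlonglongrightarrow> (a * 0 - 0 * b) / - of_real (weight 1)"
    by (rule Lim_transform_eventually)
      (use weight_pos[of 0] in \<open>auto simp: eventually_sequentially plucker[symmetric] c intro!: exI[of _ 1]\<close>)
  then have "(\<lambda>n. wronskian n f g) \<longlonglongrightarrow> 0"
    by simp
  moreover have "(\<lambda>n. wronskian n f g) \<longlonglongrightarrow> (\<Sum>k. f k * jacobi g k - jacobi f k * g k)"
    unfolding green[symmetric]
    by (intro summable_LIMSEQ' summable_diff ell2_summable_mult jacobi_domain_ell2 f g)
  ultimately have "(\<Sum>k. f k * jacobi g k - jacobi f k * g k) = 0"
    using LIMSEQ_unique by blast
  then show ?thesis
    by (simp add: suminf_diff[symmetric] ell2_summable_mult jacobi_domain_ell2 f g)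
qed

lemma finite_support_jacobi_domain:
  assumes f0: "f 0 = 0" and f: "\<And>n. n \<ge> N \<Longrightarrow> f n = 0"
  shows "f \<in> jacobi_domain"
proof -
  have ell2: "g \<in> ell2" if "g 0 = 0" "\<And>n. n \<ge> M \<Longrightarrow> g n = 0" for g :: "nat \<Rightarrow> complex" and M
    unfolding ell2_def using that by (auto intro!: summable_finite[of "{..<M}"]) (meson leI)
  have J: "jacobi f n = 0" if "n \<ge> Suc N" for n
    using that by (simp add: jacobi_def f)
  have "\<forall>\<^sub>F n in sequentially. 0 = wronskian n null_solution f"
    unfolding eventually_sequentially by (intro exI[of _ N]) (auto simp: wronskian_def f)
  then have "(\<lambda>n. wronskian n null_solution f) \<longlonglongrightarrow> 0"
    by (rule Lim_transform_eventually[OF tendsto_const])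
  then show ?thesis
    using ell2[of f N] ell2[of "jacobi f" "Suc N"] f0 f J by (simp add: jacobi_domain_def wronskian_def)
qed

text \<open>\<open>jacobi_symmetric\<close> is bilinear whereas the inner product conjugates its
  second argument; the domain is stable under conjugation since weights and
  \<open>null_solution\<close> are real.\<close>

lemma jacobi_domain_cnj:
  assumes "f \<in> jacobi_domain"
  shows "(\<lambda>n. cnj (f n)) \<in> jacobi_domain"
proof -
  have "(\<Sum>k. cnj (null_solution k * jacobi f k)) = cnj (\<Sum>k. null_solution k * jacobi f k)"
    using assms
    by (intro bounded_linear.suminf[OF bounded_linear_cnj, symmetric] ell2_summable_mult null_solution_ell2)
      (simp add: jacobi_domain_iff)
  then show ?thesis
    using assms by (simp add: jacobi_domain_iff ell2_cnj jacobi_cnj[abs_def] )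
qed

section \<open>The unitary group of the Jacobi operator\<close>

definition cmul :: "complex \<Rightarrow> l2 \<Rightarrow> l2" where
  "cmul c x = Abs_l2 (\<lambda>n. c * seq x n)"

lemma seq_cmul [simp]: "seq (cmul c x) n = c * seq x n"
  by (simp add: cmul_def ell2_mult)

lemma bounded_linear_cmul: "bounded_linear (cmul c)"
proof (rule bounded_linear_intro)
  show "cmul c (x + y) = cmul c x + cmul c y" "cmul c (r *\<^sub>R x) = r *\<^sub>R cmul c x" for x y r
    by (rule l2_eqI; simp add: algebra_simps)+
  show "norm (cmul c x) \<le> norm x * cmod c" for x
    by (simp add: ell2_norm_seq[symmetric] ell2_norm_def norm_mult power_mult_distrib
        suminf_mult ell2_summable real_sqrt_mult mult.commute)
qed

definition jacobi_l2_domain :: "l2 set" where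
  "jacobi_l2_domain = {x. seq x \<in> jacobi_domain}"

text \<open>Outside \<open>jacobi_l2_domain\<close> the sequence may leave \<open>ell2\<close>, and
  then \<open>Abs_l2\<close> gives an unspecified value.\<close>

definition skew_jacobi :: "l2 \<Rightarrow> l2" where
  "skew_jacobi x = Abs_l2 (\<lambda>n. \<i> / 2 * jacobi (seq x) n)"

abbreviation null_pairing :: "l2 \<Rightarrow> complex" where
  "null_pairing y \<equiv> (\<Sum>k. seq y k * null_solution k)"

lemma seq_skew_jacobi [simp]:
  "x \<in> jacobi_l2_domain \<Longrightarrow> seq (skew_jacobi x) n = \<i> / 2 * jacobi (seq x) n"
proof -
  assume "x \<in> jacobi_l2_domain"
  then have "(\<lambda>n. \<i> / 2 * jacobi (seq x) n) \<in> ell2"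
    unfolding jacobi_l2_domain_def by (intro ell2_mult jacobi_domain_ell2) simp
  then show ?thesis
    unfolding skew_jacobi_def by (simp only: seq_Abs_l2)
qed

text \<open>Since \<open>y\<close> is an element of \<open>l2\<close>, square summability of Jx is
  automatic. The remaining conditions are linear and continuous in \<open>x\<close> and
  \<open>y\<close>, which suits the proofs of linearity and closedness.\<close>

lemma skew_jacobi_graph_iff:
  "x \<in> jacobi_l2_domain \<and> skew_jacobi x = y \<longleftrightarrow>
    (\<forall>n. seq y n = \<i> / 2 * jacobi (seq x) n) \<and> null_pairing y = 0"
proof -
  have pairing: "null_pairing y = \<i> / 2 * (\<Sum>k. null_solution k * jacobi (seq x) k)"
    if "jacobi (seq x) \<in> ell2" "\<forall>n. seq y n = \<i> / 2 * jacobi (seq x) n"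
  proof -
    have "null_pairing y = (\<Sum>k. \<i> / 2 * (null_solution k * jacobi (seq x) k))"
      by (simp add: that(2) ac_simps)
    also have "\<dots> = \<i> / 2 * (\<Sum>k. null_solution k * jacobi (seq x) k)"
      by (intro suminf_mult ell2_summable_mult null_solution_ell2 that(1))
    finally show ?thesis .
  qed
  show ?thesis
  proof (intro iffI)
    assume l: "x \<in> jacobi_l2_domain \<and> skew_jacobi x = y"
    then have y: "\<forall>n. seq y n = \<i> / 2 * jacobi (seq x) n"
      by auto
    with l show "(\<forall>n. seq y n = \<i> / 2 * jacobi (seq x) n) \<and> null_pairing y = 0"
      using pairing by (simp add: jacobi_l2_domain_def jacobi_domain_iff)
  next
    assume r: "(\<forall>n. seq y n = \<i> / 2 * jacobi (seq x) n) \<and> null_pairing y = 0"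
    have "jacobi (seq x) n = - 2 * \<i> * (\<i> / 2 * jacobi (seq x) n)" for n
      by simp
    then have "jacobi (seq x) = (\<lambda>n. - 2 * \<i> * seq y n)"
      using r by metis
    then have ell2: "jacobi (seq x) \<in> ell2"
      using ell2_mult[OF seq_ell2, of "- 2 * \<i>" y] by simp
    then have D: "x \<in> jacobi_l2_domain"
      using r pairing[OF ell2] by (simp add: jacobi_l2_domain_def jacobi_domain_iff)
    then show "x \<in> jacobi_l2_domain \<and> skew_jacobi x = y"
      using r by (auto intro: l2_eqI)
  qed
qed

lemma skew_jacobiI:
  assumes "\<And>n. seq y n = \<i> / 2 * jacobi (seq x) n" "null_pairing y = 0"
  shows "x \<in> jacobi_l2_domain" "skew_jacobi x = y"
  using skew_jacobi_graph_iff[of x y] assms by blast+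

lemma null_pairing_skew_jacobi: "x \<in> jacobi_l2_domain \<Longrightarrow> null_pairing (skew_jacobi x) = 0"
  using skew_jacobi_graph_iff[of x "skew_jacobi x"] by auto

lemma null_pairing_add: "null_pairing (x + y) = null_pairing x + null_pairing y"
  by (simp add: distrib_right suminf_add ell2_summable_mult null_solution_ell2)

lemma null_pairing_cmul: "null_pairing (cmul c x) = c * null_pairing x"
  by (simp add: mult.assoc suminf_mult ell2_summable_mult null_solution_ell2)

lemma cmul_of_real: "cmul (of_real r) x = r *\<^sub>R x"
  by (rule l2_eqI) (simp add: scaleR_conv_of_real)

lemma skew_jacobi_add:
  assumes "x \<in> jacobi_l2_domain" "y \<in> jacobi_l2_domain"
  shows "x + y \<in> jacobi_l2_domain" "skew_jacobi (x + y) = skew_jacobi x + skew_jacobi y"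
proof -
  have "seq (skew_jacobi x + skew_jacobi y) n = \<i> / 2 * jacobi (seq (x + y)) n" for n
    using assms by (simp add: jacobi_def algebra_simps)
  moreover have "null_pairing (skew_jacobi x + skew_jacobi y) = 0"
    unfolding null_pairing_add using assms by (simp only: null_pairing_skew_jacobi add_0)
  ultimately show "x + y \<in> jacobi_l2_domain" "skew_jacobi (x + y) = skew_jacobi x + skew_jacobi y"
    using skew_jacobiI[of "skew_jacobi x + skew_jacobi y" "x + y"] by blast+
qed

lemma skew_jacobi_cmul:
  assumes "x \<in> jacobi_l2_domain"
  shows "cmul c x \<in> jacobi_l2_domain" "skew_jacobi (cmul c x) = cmul c (skew_jacobi x)"
proof -
  have "seq (cmul c (skew_jacobi x)) n = \<i> / 2 * jacobi (seq (cmul c x)) n" for n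
    using assms by (simp add: jacobi_def algebra_simps)
  moreover have "null_pairing (cmul c (skew_jacobi x)) = 0"
    unfolding null_pairing_cmul using assms by (simp only: null_pairing_skew_jacobi mult_zero_right)
  ultimately show "cmul c x \<in> jacobi_l2_domain" "skew_jacobi (cmul c x) = cmul c (skew_jacobi x)"
    using skew_jacobiI[of "cmul c (skew_jacobi x)" "cmul c x"] by blast+
qed

lemma skew_operator_jacobi: "skew_operator jacobi_l2_domain skew_jacobi"
proof
  fix x y :: l2 and r :: real
  show "subspace jacobi_l2_domain"
  proof (rule subspaceI)
    show "0 \<in> jacobi_l2_domain"
      by (rule skew_jacobiI(1)[of 0]) (simp_all add: jacobi_def)
    show "r *\<^sub>R x \<in> jacobi_l2_domain" if "x \<in> jacobi_l2_domain" for r x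
      using skew_jacobi_cmul[OF that, of "of_real r"] by (simp add: cmul_of_real)
  qed (rule skew_jacobi_add)
  show "closure jacobi_l2_domain = UNIV"
  proof (rule closure_finite_support)
    fix f :: "nat \<Rightarrow> complex" and N
    assume "f 0 = 0" "\<And>n. n \<ge> N \<Longrightarrow> f n = 0"
    then have "f \<in> jacobi_domain"
      by (rule finite_support_jacobi_domain)
    then show "Abs_l2 f \<in> jacobi_l2_domain"
      by (simp add: jacobi_l2_domain_def jacobi_domain_ell2)
  qed
  assume x: "x \<in> jacobi_l2_domain"
  show "skew_jacobi (r *\<^sub>R x) = r *\<^sub>R skew_jacobi x"
    using skew_jacobi_cmul[OF x, of "of_real r"] by (simp add: cmul_of_real)
  show "y \<in> jacobi_l2_domain \<Longrightarrow> skew_jacobi (x + y) = skew_jacobi x + skew_jacobi y"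
    using x by (rule skew_jacobi_add)
  have xd: "seq x \<in> jacobi_domain"
    using x by (simp add: jacobi_l2_domain_def)
  let ?s = "\<Sum>k. jacobi (seq x) k * cnj (seq x k)"
  have summ: "summable (\<lambda>k. jacobi (seq x) k * cnj (seq x k))"
    by (intro ell2_summable_mult ell2_cnj seq_ell2 jacobi_domain_ell2 xd)
  \<comment> \<open>Symmetry for \<open>x\<close> and its conjugate makes <Jx, x> real, so the
    factor \<i> / 2 leaves no real part.\<close>
  have "?s = (\<Sum>k. seq x k * cnj (jacobi (seq x) k))"
    using jacobi_symmetric[OF xd jacobi_domain_cnj[OF xd]] by (simp add: jacobi_cnj)
  also have "\<dots> = cnj ?s"
    using bounded_linear.suminf[OF bounded_linear_cnj summ] by (simp add: mult.commute)
  finally have "Im ?s = 0"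
    by (simp add: complex_eq_iff)
  moreover have "(\<Sum>k. seq (skew_jacobi x) k * cnj (seq x k)) =
      (\<Sum>k. \<i> / 2 * (jacobi (seq x) k * cnj (seq x k)))"
    by (simp add: x mult.assoc)
  then have "inner (skew_jacobi x) x = Re (\<i> / 2 * ?s)"
    by (simp only: inner_l2_complex suminf_mult[OF summ])
  ultimately show "inner (skew_jacobi x) x = 0"
    by simp
qed

lemma null_pairing_eq_0_iff:
  "null_pairing y = 0 \<longleftrightarrow>
    inner y (Abs_l2 null_solution) = 0 \<and> inner y (cmul \<i> (Abs_l2 null_solution)) = 0"
proof -
  have "(\<Sum>k. seq y k * cnj (\<i> * null_solution k)) = - \<i> * null_pairing y"
    using suminf_mult[OF ell2_summable_mult[OF seq_ell2 null_solution_ell2], of "- \<i>" y]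
    by (simp add: ac_simps)
  then show ?thesis
    by (simp add: inner_l2_complex null_solution_ell2 complex_eq_iff)
qed

lemma unit_jacobi_domain: "1 \<le> n \<Longrightarrow> Abs_l2 (unit n c) \<in> jacobi_l2_domain"
  using finite_support_jacobi_domain[of "unit n c" "Suc n"]
  by (simp add: jacobi_l2_domain_def unit_ell2) (simp add: unit_def)

lemma inner_unit: "1 \<le> n \<Longrightarrow> inner y (Abs_l2 (unit n c)) = Re (seq y n * cnj c)"
  unfolding inner_l2_complex
  by (subst suminf_finite[of "{n}"]) (auto simp: unit_ell2 unit_def)

text \<open>Here \<open>y\<close> is arbitrary in \<open>l2\<close>: against a finitely supported
  vector, Green's identity has no boundary term.\<close>

lemma inner_skew_jacobi_unit:
  assumes n: "1 \<le> n"
  shows "inner y (skew_jacobi (Abs_l2 (unit n c))) = - Re (\<i> / 2 * jacobi (seq y) n * cnj c)"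
proof -
  let ?u = "unit n (cnj c)"
  \<comment> \<open>The cut is at \<open>Suc n\<close>, not \<open>n\<close>, because the Wronskian
    at \<open>n\<close> still sees the entry of the unit vector.\<close>
  have "wronskian (Suc n) (seq y) ?u = 0"
    by (simp add: wronskian_def unit_def)
  then have "(\<Sum>k\<le>Suc n. seq y k * jacobi ?u k) = (\<Sum>k\<le>Suc n. jacobi (seq y) k * ?u k)"
    using green[of "seq y" ?u "Suc n"] by (simp add: sum_subtractf)
  also have "\<dots> = (\<Sum>k\<le>Suc n. if k = n then jacobi (seq y) n * cnj c else 0)"
    by (intro sum.cong) (auto simp: unit_def)
  also have "\<dots> = jacobi (seq y) n * cnj c"
    by (subst sum.delta) auto
  finally have sum: "(\<Sum>k\<le>Suc n. seq y k * jacobi ?u k) = jacobi (seq y) n * cnj c" .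
  have cn: "cnj (jacobi (unit n c) k) = jacobi ?u k" for k
    by (simp add: jacobi_def unit_def)
  have "(\<Sum>k. seq y k * cnj (seq (skew_jacobi (Abs_l2 (unit n c))) k)) =
      (\<Sum>k. - \<i> / 2 * (seq y k * jacobi ?u k))"
    using n by (simp add: unit_jacobi_domain unit_ell2 cn mult.left_commute)
  also have "\<dots> = (\<Sum>k\<le>Suc n. - \<i> / 2 * (seq y k * jacobi ?u k))"
    by (rule suminf_finite) (auto simp: jacobi_def unit_def)
  also have "\<dots> = - \<i> / 2 * (jacobi (seq y) n * cnj c)"
    unfolding sum[symmetric] by (rule sum_distrib_left[symmetric])
  finally show ?thesis
    unfolding inner_l2_complex by (simp add: algebra_simps)
qed

lemma skew_adjoint_operator_jacobi: "skew_adjoint_operator jacobi_l2_domain skew_jacobi"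
proof -
  interpret skew_operator jacobi_l2_domain skew_jacobi
    by (rule skew_operator_jacobi)
  show ?thesis
  proof (rule skew_adjoint_operatorI)
    fix X x y
    assume X: "\<And>n. X n \<in> jacobi_l2_domain" "X \<longlonglongrightarrow> x" "(\<lambda>n. skew_jacobi (X n)) \<longlonglongrightarrow> y"
    have lim: "(\<lambda>m. seq (Y m) k) \<longlonglongrightarrow> seq z k" if "Y \<longlonglongrightarrow> z" for Y z k
      by (rule bounded_linear.tendsto[OF bounded_linear_seq that])
    have y: "seq y k = \<i> / 2 * jacobi (seq x) k" for k
    proof -
      have "(\<lambda>m. \<i> / 2 * jacobi (seq (X m)) k) \<longlonglongrightarrow> \<i> / 2 * jacobi (seq x) k"
        unfolding jacobi_def by (intro tendsto_intros lim X)
      moreover have "(\<lambda>m. \<i> / 2 * jacobi (seq (X m)) k) \<longlonglongrightarrow> seq y k"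
        using lim[OF X(3), of k] X(1) by simp
      ultimately show ?thesis
        by (rule LIMSEQ_unique[rotated])
    qed
    have "inner y v = 0" if "\<And>m. inner (skew_jacobi (X m)) v = 0" for v
      using tendsto_inner[OF X(3) tendsto_const[of v]] that by (simp add: LIMSEQ_const_iff)
    then have "null_pairing y = 0"
      using X(1) null_pairing_skew_jacobi unfolding null_pairing_eq_0_iff by auto
    with y show "x \<in> jacobi_l2_domain \<and> skew_jacobi x = y"
      by (simp add: skew_jacobi_graph_iff)
  next
    fix h z
    assume h: "h \<noteq> 0"
      and orth: "\<And>x. x \<in> jacobi_l2_domain \<Longrightarrow> inner (x - h *\<^sub>R skew_jacobi x) z = 0"
    let ?y = "(- 1 / h) *\<^sub>R z"
    \<comment> \<open>Testing with unit vectors gives row \<open>n\<close> of the adjoint equation;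
      \<open>c\<close> = 1 and \<open>c\<close> = \<i> recover the complex identity.\<close>
    have *: "Re (seq z n * cnj c) = Re (- of_real h * (\<i> / 2 * jacobi (seq z) n) * cnj c)"
      if n: "1 \<le> n" for n c
    proof -
      have "inner z (Abs_l2 (unit n c)) = h * inner z (skew_jacobi (Abs_l2 (unit n c)))"
        using orth[OF unit_jacobi_domain[OF n, of c]]
        by (simp add: inner_diff_left inner_commute[of _ z] inner_diff_right)
      then show ?thesis
        by (simp add: inner_unit[OF n] inner_skew_jacobi_unit[OF n] algebra_simps)
    qed
    have z: "seq z n = - of_real h * (\<i> / 2 * jacobi (seq z) n)" for n
    proof (cases "n = 0")
      case False
      then show ?thesis
        using *[of n 1] *[of n \<i>] by (simp add: complex_eq_iff)
    qed simp
    have y: "seq ?y n = \<i> / 2 * jacobi (seq z) n" for n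
      using h by (subst (1) seq_simps(3), subst z) (simp add: scaleR_conv_of_real)
    \<comment> \<open>With B v = 0 the orthogonality hypothesis reduces to \<open>z\<close> being
      orthogonal to v and to \<i> v, which is the boundary condition for \<open>z\<close>.\<close>
    have null: "Abs_l2 null_solution \<in> jacobi_l2_domain" "skew_jacobi (Abs_l2 null_solution) = 0"
      by (rule skew_jacobiI(1)[of 0] skew_jacobiI(2), simp_all add: null_solution_ell2)+
    have "inner ?y (Abs_l2 null_solution) = 0" "inner ?y (cmul \<i> (Abs_l2 null_solution)) = 0"
      using orth[OF null(1)] orth[OF skew_jacobi_cmul(1)[OF null(1)], of \<i>] skew_jacobi_cmul(2)[OF null(1)]
      by (simp_all add: null(2) inner_commute cmul_def zero_l2_def[symmetric])
    then have "z \<in> jacobi_l2_domain" "skew_jacobi z = ?y"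
      using skew_jacobiI[OF y] unfolding null_pairing_eq_0_iff by auto
    then have "inner ?y z = 0"
      using B_skew by metis
    then show "z = 0"
      using h by simp
  qed
qed

interpretation jacobi: skew_adjoint_operator jacobi_l2_domain skew_jacobi
  by (rule skew_adjoint_operator_jacobi)

interpretation jacobi_group: generated_group jacobi_l2_domain skew_jacobi jacobi.group
  by (rule jacobi.generated_group_group)

lemma group_cmul: "jacobi.group t (cmul c x) = cmul c (jacobi.group t x)"
  using generated_group_intertwine[where K = "cmul c", OF jacobi.generated_group_group
      jacobi.generated_group_group bounded_linear_cmul skew_jacobi_cmul] by metis

lemma group_component_derivative:
  assumes n: "1 \<le> n"
  shows "((\<lambda>t. seq (jacobi.group t x) n) has_vector_derivative
    \<i> / 2 * jacobi (seq (jacobi.group t x)) n) (at t)"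
proof -
  have "((\<lambda>t. Re (seq (jacobi.group t x) n * cnj c)) has_vector_derivative
      Re (\<i> / 2 * jacobi (seq (jacobi.group t x)) n * cnj c)) (at t)" for c
    using jacobi_group.U_weak_derivative[OF unit_jacobi_domain[OF n, of c], of x t]
    unfolding inner_unit[OF n] inner_skew_jacobi_unit[OF n] by simp
  from this[of 1] this[of \<i>] show ?thesis
    by (simp add: has_vector_derivative_complex_iff has_real_derivative_iff_has_vector_derivative)
qed

section \<open>Transport between operator groups on sequences and on \<open>l2\<close>\<close>

lemma norm_Abs_l2: "f \<in> ell2 \<Longrightarrow> norm (Abs_l2 f) = ell2_norm f"
  by (simp add: ell2_norm_seq[symmetric])

lemma diff_quotient_tendsto_iff:
  assumes f: "f \<in> ell2" and g: "g \<in> ell2" and U: "\<And>h. U h \<in> ell2"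
  shows "((\<lambda>h. ell2_norm (\<lambda>n. (U h n - f n) / of_real h - g n)) \<longlongrightarrow> 0) (at 0) \<longleftrightarrow>
    ((\<lambda>h. (Abs_l2 (U h) - Abs_l2 f) /\<^sub>R h) \<longlongrightarrow> Abs_l2 g) (at 0)"
proof -
  \<comment> \<open>The equality includes \<open>h\<close> = 0, where division and inverse both
    yield 0.\<close>
  have "ell2_norm (\<lambda>n. (U h n - f n) / of_real h - g n) =
      norm ((Abs_l2 (U h) - Abs_l2 f) /\<^sub>R h - Abs_l2 g)" for h
  proof -
    have "(\<lambda>n. (U h n - f n) / of_real h - g n) = seq ((Abs_l2 (U h) - Abs_l2 f) /\<^sub>R h - Abs_l2 g)"
      using f g U by (auto simp: fun_eq_iff scaleR_conv_of_real divide_inverse mult.commute)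
    then show ?thesis
      by (simp only: ell2_norm_seq)
  qed
  then show ?thesis
    by (simp only: tendsto_norm_zero_iff LIM_zero_iff)
qed

lemma diff_tendsto_iff:
  assumes f: "f \<in> ell2" and U: "\<And>h. U h \<in> ell2"
  shows "((\<lambda>h. ell2_norm (\<lambda>n. U h n - f n)) \<longlongrightarrow> 0) F \<longleftrightarrow>
    ((\<lambda>h. Abs_l2 (U h)) \<longlongrightarrow> Abs_l2 f) F"
proof -
  have "ell2_norm (\<lambda>n. U h n - f n) = norm (Abs_l2 (U h) - Abs_l2 f)" for h
  proof -
    have "(\<lambda>n. U h n - f n) = seq (Abs_l2 (U h) - Abs_l2 f)"
      using f U by (auto simp: fun_eq_iff)
    then show ?thesis
      by (simp only: ell2_norm_seq)
  qed
  then show ?thesis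
    by (simp only: tendsto_norm_zero_iff LIM_zero_iff)
qed

lemma domain_Abs_l2:
  assumes "f \<in> ell2" "g \<in> ell2"
  shows "Abs_l2 f \<in> jacobi_l2_domain \<and> Abs_l2 g = skew_jacobi (Abs_l2 f) \<longleftrightarrow>
    f \<in> jacobi_domain \<and> g = (\<lambda>n. \<i> / 2 * jacobi f n)"
proof (cases "f \<in> jacobi_domain")
  case True
  then have "(\<lambda>n. \<i> / 2 * jacobi f n) \<in> ell2"
    by (intro ell2_mult jacobi_domain_ell2)
  then show ?thesis
    using True assms Abs_l2_inject by (simp add: jacobi_l2_domain_def skew_jacobi_def)
qed (simp add: jacobi_l2_domain_def assms)

text \<open>Any solution operator becomes a group on \<open>l2\<close> with generator
  \<open>skew_jacobi\<close>, so that \<open>generated_group_intertwine\<close> can identify it with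
  \<open>jacobi.group\<close>.\<close>

lemma generated_group_of_solution_operator:
  assumes "is_solution_operator U"
  shows "generated_group jacobi_l2_domain skew_jacobi (\<lambda>t x. Abs_l2 (U t (seq x)))"
proof -
  note solution_op = assms[unfolded is_solution_operator_def generates_def]
  have C0: "C0_group U"
    using solution_op by (rule conjunct1)
  have gen: "((\<lambda>h. ell2_norm (\<lambda>n. (U h f n - f n) / of_real h - g n)) \<longlongrightarrow> 0) (at 0)
      \<longleftrightarrow> f \<in> jacobi_domain \<and> g = (\<lambda>n. \<i> / 2 * jacobi f n)"
    if "f \<in> ell2" "g \<in> ell2" for f g
    by (rule bspec[OF bspec[OF conjunct2[OF solution_op]]]) (fact that)+
  have U: "\<And>t f. f \<in> ell2 \<Longrightarrow> U t f \<in> ell2"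
    and lin: "\<And>t c d f g. f \<in> ell2 \<Longrightarrow> g \<in> ell2 \<Longrightarrow>
      U t (\<lambda>n. c * f n + d * g n) = (\<lambda>n. c * U t f n + d * U t g n)"
    and bd: "\<And>t. \<exists>C. \<forall>f\<in>ell2. ell2_norm (U t f) \<le> C * ell2_norm f"
    and U0: "\<And>f. f \<in> ell2 \<Longrightarrow> U 0 f = f"
    and Uplus: "\<And>s t f. f \<in> ell2 \<Longrightarrow> U (s + t) f = U s (U t f)"
    and cont: "\<And>f. f \<in> ell2 \<Longrightarrow> ((\<lambda>t. ell2_norm (\<lambda>n. U t f n - f n)) \<longlongrightarrow> 0) (at 0)"
    using C0 unfolding C0_group_def by blast+
  show ?thesis
  proof (intro generated_group.intro generated_group_axioms.intro skew_operator_jacobi)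
    fix s t :: real and x y :: l2
    show "bounded_linear (\<lambda>x. Abs_l2 (U t (seq x)))"
    proof -
      obtain C where C: "\<And>f. f \<in> ell2 \<Longrightarrow> ell2_norm (U t f) \<le> C * ell2_norm f"
        using bd by blast
      show ?thesis
      proof (rule bounded_linear_intro)
        fix x y :: l2 and r :: real
        have "seq (x + y) = (\<lambda>n. 1 * seq x n + 1 * seq y n)"
          by auto
        then show "Abs_l2 (U t (seq (x + y))) = Abs_l2 (U t (seq x)) + Abs_l2 (U t (seq y))"
          using lin[of "seq x" "seq y" t 1 1] by (intro l2_eqI) (simp add: U ell2_add)
        have "seq (r *\<^sub>R x) = (\<lambda>n. of_real r * seq x n + 0 * seq x n)"
          by (auto simp: scaleR_conv_of_real)
        then show "Abs_l2 (U t (seq (r *\<^sub>R x))) = r *\<^sub>R Abs_l2 (U t (seq x))"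
          using lin[of "seq x" "seq x" t "of_real r" 0]
          by (intro l2_eqI) (simp add: U ell2_mult scaleR_conv_of_real)
        show "norm (Abs_l2 (U t (seq x))) \<le> norm x * C"
          using C[OF seq_ell2, of x] by (simp add: ell2_norm_seq[symmetric] U mult.commute)
      qed
    qed
    show "Abs_l2 (U 0 (seq x)) = x"
      by (simp add: U0 seq_inverse)
    show "Abs_l2 (U (s + t) (seq x)) = Abs_l2 (U s (seq (Abs_l2 (U t (seq x)))))"
      by (simp add: Uplus U)
    show "((\<lambda>t. Abs_l2 (U t (seq x))) \<longlongrightarrow> x) (at 0)"
      using cont[OF seq_ell2] diff_tendsto_iff[where F = "at 0", OF seq_ell2, of "\<lambda>t. U t (seq x)" x]
      by (simp add: U seq_inverse)
    show "((\<lambda>h. (Abs_l2 (U h (seq x)) - x) /\<^sub>R h) \<longlongrightarrow> y) (at 0) \<longleftrightarrow>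
        x \<in> jacobi_l2_domain \<and> y = skew_jacobi x"
      using gen[of "seq x" "seq y"] domain_Abs_l2[of "seq x" "seq y"]
        diff_quotient_tendsto_iff[of "seq x" "seq y" "\<lambda>h. U h (seq x)"]
      by (simp add: U seq_inverse)
  qed
qed

lemma solution_operator_unique:
  assumes "is_solution_operator U" "f \<in> ell2"
  shows "U t f = seq (jacobi.group t (Abs_l2 f))"
proof -
  have "jacobi.group t (Abs_l2 f) = Abs_l2 (U t (seq (Abs_l2 f)))"
    by (rule generated_group_intertwine[OF jacobi.generated_group_group
        generated_group_of_solution_operator[OF assms(1)] bounded_linear_ident]) auto
  moreover have "U t f \<in> ell2"
    using assms unfolding is_solution_operator_def generates_def C0_group_def by blast
  ultimately show ?thesis
    using assms(2) by simp
qed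

lemma is_solution_operator_group: "is_solution_operator (\<lambda>t f. seq (jacobi.group t (Abs_l2 f)))"
  unfolding is_solution_operator_def generates_def C0_group_def
proof (intro conjI allI ballI)
  fix f :: "nat \<Rightarrow> complex"
  assume f: "f \<in> ell2"
  show "seq (jacobi.group 0 (Abs_l2 f)) = f"
    using f by (simp add: jacobi_group.U_0)
  show "seq (jacobi.group (s + t) (Abs_l2 f)) =
      seq (jacobi.group s (Abs_l2 (seq (jacobi.group t (Abs_l2 f)))))" for s t
    by (simp add: jacobi_group.U_plus seq_inverse)
  show "((\<lambda>t. ell2_norm (\<lambda>n. seq (jacobi.group t (Abs_l2 f)) n - f n)) \<longlongrightarrow> 0) (at 0)"
    using diff_tendsto_iff[OF f, of "\<lambda>t. seq (jacobi.group t (Abs_l2 f))"]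
    by (simp add: seq_inverse jacobi_group.U_continuous)
  fix g :: "nat \<Rightarrow> complex"
  assume g: "g \<in> ell2"
  show "((\<lambda>h. ell2_norm (\<lambda>n. (seq (jacobi.group h (Abs_l2 f)) n - f n) / of_real h - g n)) \<longlongrightarrow> 0) (at 0)
      \<longleftrightarrow> f \<in> jacobi_domain \<and> g = (\<lambda>n. \<i> / 2 * jacobi f n)"
    using diff_quotient_tendsto_iff[OF f g, of "\<lambda>h. seq (jacobi.group h (Abs_l2 f))"]
      domain_Abs_l2[OF f g]
    by (simp add: seq_inverse jacobi_group.U_generator)
  fix t :: real and c d :: complex
  have "Abs_l2 (\<lambda>n. c * f n + d * g n) = cmul c (Abs_l2 f) + cmul d (Abs_l2 g)"
    using f g by (intro l2_eqI) (simp add: ell2_add ell2_mult)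
  then show "seq (jacobi.group t (Abs_l2 (\<lambda>n. c * f n + d * g n))) =
      (\<lambda>n. c * seq (jacobi.group t (Abs_l2 f)) n + d * seq (jacobi.group t (Abs_l2 g)) n)"
    using linear_add[OF bounded_linear.linear[OF jacobi_group.bounded_linear_U]]
    by (auto simp: fun_eq_iff group_cmul)
next
  show "\<exists>C. \<forall>f\<in>ell2. ell2_norm (seq (jacobi.group t (Abs_l2 f))) \<le> C * ell2_norm f" for t
    by (intro exI[of _ 1]) (simp add: ell2_norm_seq jacobi_group.norm_U norm_Abs_l2)
qed simp

section \<open>Return to the original unknowns\<close>

definition solution :: "(nat \<Rightarrow> complex) \<Rightarrow> real \<Rightarrow> nat \<Rightarrow> complex" where
  "solution a0 t n = \<i> ^ n * seq (jacobi.group t (Abs_l2 (\<lambda>n. (- \<i>) ^ n * a0 n))) n"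

lemma i_power_cancel: "\<i> ^ n * ((- \<i>) ^ n * z) = z" "(- \<i>) ^ n * (\<i> ^ n * z) = z"
  by (simp_all add: mult.assoc[symmetric] power_mult_distrib[symmetric])

lemma twist_ell2: "cmod c = 1 \<Longrightarrow> (\<lambda>n. c ^ n * f n) \<in> ell2 \<longleftrightarrow> f \<in> ell2"
  by (auto simp: ell2_def norm_mult norm_power)

lemma ell2_norm_twist: "cmod c = 1 \<Longrightarrow> ell2_norm (\<lambda>n. c ^ n * f n) = ell2_norm f"
  by (simp add: ell2_norm_def norm_mult norm_power)

lemma satisfies_system_solution: "satisfies_system (solution a0)"
  unfolding satisfies_system_def
proof (intro allI impI)
  fix t n
  assume "1 \<le> (n :: nat)"
  then obtain m where m: "n = Suc m"
    by (cases n) auto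
  let ?x = "\<lambda>t. jacobi.group t (Abs_l2 (\<lambda>n. (- \<i>) ^ n * a0 n))"
  have "((\<lambda>s. 2 * \<i> ^ n * seq (?x s) n) has_vector_derivative
      2 * \<i> ^ n * (\<i> / 2 * jacobi (seq (?x t)) n)) (at t)"
    using m by (intro has_vector_derivative_mult_right group_component_derivative) simp
  \<comment> \<open>The factor \<i>^(n+1) matches a_(n+1) directly and equals -\<i>^(n-1), which
    produces the minus sign in front of a_(n-1).\<close>
  moreover have "2 * \<i> ^ n * (\<i> / 2 * jacobi (seq (?x t)) n) =
      of_real (weight n) * solution a0 t (n + 1) - of_real (weight (n - 1)) * solution a0 t (n - 1)"
    by (simp add: m jacobi_def solution_def algebra_simps)
  moreover have "weight (n - 1) = sqrt ((real n - 1) * real n * (real n + 1))"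
    by (simp add: m weight_def ac_simps)
  ultimately show "((\<lambda>s. 2 * solution a0 s n) has_vector_derivative
      of_real (sqrt (real n * (real n + 1) * (real n + 2))) * solution a0 t (n + 1) -
      of_real (sqrt ((real n - 1) * real n * (real n + 1))) * solution a0 t (n - 1)) (at t)"
    by (simp add: solution_def weight_def mult.assoc)
qed

lemma solution_unique:
  assumes a: "is_solution a"
  shows "a = solution (a 0)"
proof -
  obtain U f where U: "is_solution_operator U" and f: "\<And>t n. a t n = \<i> ^ n * f t n" "\<And>t. f t = U t (f 0)"
    using a unfolding is_solution_def by blast
  have f0: "f 0 = (\<lambda>n. (- \<i>) ^ n * a 0 n)"
    by (simp add: f(1) i_power_cancel)
  have "a 0 \<in> ell2"
    using a by (simp add: is_solution_def)
  then have "f 0 \<in> ell2"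
    unfolding f0 by (simp add: twist_ell2)
  then have ft: "f t = seq (jacobi.group t (Abs_l2 (f 0)))" for t
    using solution_operator_unique[OF U] f(2) by metis
  have "a t n = solution (a 0) t n" for t n
    unfolding solution_def f0[symmetric] f(1)[of t n] ft[of t] ..
  then show ?thesis
    by (simp add: fun_eq_iff)
qed

lemma solution_0: "a0 \<in> ell2 \<Longrightarrow> solution a0 0 = a0"
  by (simp add: solution_def fun_eq_iff jacobi_group.U_0 twist_ell2 i_power_cancel)

lemma is_solution_solution:
  assumes "a0 \<in> ell2"
  shows "is_solution (solution a0)"
  unfolding is_solution_def
proof (intro conjI allI satisfies_system_solution)
  let ?f = "\<lambda>t. seq (jacobi.group t (Abs_l2 (\<lambda>n. (- \<i>) ^ n * a0 n)))"
  show "solution a0 t \<in> ell2" for t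
    using twist_ell2[of \<i> "?f t"] by (simp add: solution_def[abs_def])
  show "\<exists>U f. is_solution_operator U \<and> (\<forall>t n. solution a0 t n = \<i> ^ n * f t n) \<and> (\<forall>t. f t = U t (f 0))"
    by (rule exI[of _ "\<lambda>t f. seq (jacobi.group t (Abs_l2 f))"], rule exI[of _ ?f])
      (simp add: is_solution_operator_group solution_def jacobi_group.U_0 seq_inverse)
qed

lemma ell2_norm_solution: "ell2_norm (solution a0 t) = ell2_norm (solution a0 0)"
  by (simp add: solution_def[abs_def] ell2_norm_twist ell2_norm_seq jacobi_group.norm_U)

theorem theorem4p3:
  fixes a0 :: "nat \<Rightarrow> complex"
  assumes "a0 \<in> ell2"
  shows "(\<exists>!a. is_solution a \<and> a 0 = a0) \<and>
    (\<forall>a. is_solution a \<and> a 0 = a0 \<longrightarrow> (\<forall>t. ell2_norm (a t) = ell2_norm (a 0)))"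
proof -
  have eq: "a = solution a0" if "is_solution a \<and> a 0 = a0" for a
    using solution_unique that by blast
  show ?thesis
  proof (intro conjI allI impI)
    show "\<exists>!a. is_solution a \<and> a 0 = a0"
      by (rule ex1I[of _ "solution a0"]) (simp_all add: is_solution_solution solution_0 assms eq)
    show "ell2_norm (a t) = ell2_norm (a 0)" if "is_solution a \<and> a 0 = a0" for a t
      unfolding eq[OF that] by (rule ell2_norm_solution)
  qed
qed

end
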